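(* $\mathsf{EM}$ admits preservation of $\Delta^0_2$-definitions: for every set $Z$ and every $Z$-computable tournament $R$ on $\omega$, there exists an infinite $R$-transitive set $G$ which preserves $\Delta^0_2$-definitions relative to $Z$.
   Context: A tournament is a binary relation $R\subseteq\omega\times\omega$ induced by a coloring $c:[\omega]^2\to 2$ as follows: for $x<y$, if $c(x,y)=1$ then $xRy$, and if $c(x,y)=0$ then $yRx$. A set $X$ is $R$-transitive if $R\cap X^2$ is transitive. $\mathsf{EM}$ (Erdős–Moser principle) states that every tournament has an infinite transitive set. A set is properly $\Delta^0_2$ relative to $X$ if it is $\Delta^0_2$ relative to $X$ but neither $\Sigma^0_1$ nor $\Pi^0_1$ relative to $X$. A set $Y$ preserves $\Delta^0_2$-definitions relative to $X$ if every set that is properly $\Delta^0_2$ relative to $X$ is properly $\Delta^0_2$ relative to $X\oplus Y$. *)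

theory Defs
  imports "HOL-Library.Ramsey"
begin

section \<open>Computability relative to an oracle\<close>

text \<open>
  Programs for the partial recursive functions relative to an oracle (a set of natural
  numbers): Kleene's basic functions, the characteristic function of the oracle, and closure
  under composition, primitive recursion and unbounded minimisation. A program does not carry
  an arity: it is run on a list of arguments, and is undefined on lists of an unsuitable length.
\<close>

datatype prog =
    Zero
  | Succ
  | Proj nat
  | Query
  | Comp prog "prog list"
  | PrimRec prog prog
  | Mu prog

text \<open>
  \<open>eval X e xs y\<close> says that program \<open>e\<close> with oracle \<open>X\<close>, run on the arguments \<open>xs\<close>,
  halts with output \<open>y\<close>. In primitive recursion and minimisation the recursion (search)
  variable is the first argument; minimisation requires all the values before the first
  zero to be defined.
\<close>

inductive eval :: "nat set \<Rightarrow> prog \<Rightarrow> nat list \<Rightarrow> nat \<Rightarrow> bool" for X :: "nat set" where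
  eval_Zero: "eval X Zero xs 0"
| eval_Succ: "eval X Succ [n] (Suc n)"
| eval_Proj: "i < length xs \<Longrightarrow> eval X (Proj i) xs (xs ! i)"
| eval_Query: "eval X Query [n] (if n \<in> X then 1 else 0)"
| eval_Comp: "list_all2 (\<lambda>g y. eval X g xs y) gs ys \<Longrightarrow> eval X f ys z
    \<Longrightarrow> eval X (Comp f gs) xs z"
| eval_PrimRec_0: "eval X f xs y \<Longrightarrow> eval X (PrimRec f g) (0 # xs) y"
| eval_PrimRec_Suc: "eval X (PrimRec f g) (n # xs) r \<Longrightarrow> eval X g (n # r # xs) y
    \<Longrightarrow> eval X (PrimRec f g) (Suc n # xs) y"
| eval_Mu: "eval X f (n # xs) 0 \<Longrightarrow> \<forall>m<n. \<exists>k. eval X f (m # xs) (Suc k)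
    \<Longrightarrow> eval X (Mu f) xs n"

lemma eval_functional: "eval X e xs y \<Longrightarrow> eval X e xs z \<Longrightarrow> y = z"
proof (induction arbitrary: z rule: eval.induct)
  case (eval_Comp xs gs ys f z')
  from eval_Comp.prems obtain ys' where
    ys': "list_all2 (\<lambda>g y. eval X g xs y) gs ys'" "eval X f ys' z"
    by (auto elim: eval.cases)
  have "ys = ys'"
    using eval_Comp.IH(1) ys'(1) by (auto simp: list_all2_conv_all_nth intro!: nth_equalityI)
  with ys'(2) eval_Comp.IH(2) show ?case by simp
next
  case (eval_PrimRec_0 f xs y g)
  from eval_PrimRec_0.prems have "eval X f xs z" by (auto elim: eval.cases)
  then show ?case by (rule eval_PrimRec_0.IH)
next
  case (eval_PrimRec_Suc f g n xs r y)
  from eval_PrimRec_Suc.prems obtain r' where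
    "eval X (PrimRec f g) (n # xs) r'" "eval X g (n # r' # xs) z"
    by (auto elim: eval.cases)
  with eval_PrimRec_Suc.IH show ?case by metis
next
  case (eval_Mu f n xs)
  from eval_Mu.prems have z: "eval X f (z # xs) 0" "\<forall>m<z. \<exists>k. eval X f (m # xs) (Suc k)"
    by (auto elim: eval.cases)
  have "\<not> n < z" using eval_Mu.IH(1) z(2) by fastforce
  moreover have "\<not> z < n" using eval_Mu.IH(2) z(1) by fastforce
  ultimately show ?case by simp
qed (auto elim: eval.cases)

text \<open>An \<open>n\<close>-ary relation on the natural numbers is represented as a predicate on lists, of
  which only the values on lists of length \<open>n\<close> matter.\<close>

definition computable_rel :: "nat set \<Rightarrow> nat \<Rightarrow> (nat list \<Rightarrow> bool) \<Rightarrow> bool" where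
  "computable_rel X n P \<longleftrightarrow>
     (\<exists>e. \<forall>xs. length xs = n \<longrightarrow> eval X e xs (if P xs then 1 else 0))"


section \<open>The arithmetical hierarchy relative to an oracle\<close>

definition Sigma01 :: "nat set \<Rightarrow> nat set \<Rightarrow> bool" where
  "Sigma01 X A \<longleftrightarrow> (\<exists>P. computable_rel X 2 P \<and> A = {x. \<exists>y. P [x, y]})"

definition Pi01 :: "nat set \<Rightarrow> nat set \<Rightarrow> bool" where
  "Pi01 X A \<longleftrightarrow> (\<exists>P. computable_rel X 2 P \<and> A = {x. \<forall>y. P [x, y]})"

definition Sigma02 :: "nat set \<Rightarrow> nat set \<Rightarrow> bool" where
  "Sigma02 X A \<longleftrightarrow> (\<exists>P. computable_rel X 3 P \<and> A = {x. \<exists>y. \<forall>z. P [x, y, z]})"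

definition Pi02 :: "nat set \<Rightarrow> nat set \<Rightarrow> bool" where
  "Pi02 X A \<longleftrightarrow> (\<exists>P. computable_rel X 3 P \<and> A = {x. \<forall>y. \<exists>z. P [x, y, z]})"

definition Delta02 :: "nat set \<Rightarrow> nat set \<Rightarrow> bool" where
  "Delta02 X A \<longleftrightarrow> Sigma02 X A \<and> Pi02 X A"

definition properly_Delta02 :: "nat set \<Rightarrow> nat set \<Rightarrow> bool" where
  "properly_Delta02 X A \<longleftrightarrow> Delta02 X A \<and> \<not> Sigma01 X A \<and> \<not> Pi01 X A"

definition join :: "nat set \<Rightarrow> nat set \<Rightarrow> nat set" (infixl "\<oplus>" 65) where
  "X \<oplus> Y = {2 * n | n. n \<in> X} \<union> {2 * n + 1 | n. n \<in> Y}"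

text \<open>\<open>preserves_Delta02_definitions X Y\<close>: the set \<open>Y\<close> preserves $\Delta^0_2$-definitions
  relative to \<open>X\<close>.\<close>

definition preserves_Delta02_definitions :: "nat set \<Rightarrow> nat set \<Rightarrow> bool" where
  "preserves_Delta02_definitions X Y \<longleftrightarrow>
     (\<forall>A. properly_Delta02 X A \<longrightarrow> properly_Delta02 (X \<oplus> Y) A)"


section \<open>Tournaments\<close>

definition induced_by :: "(nat \<times> nat) set \<Rightarrow> (nat set \<Rightarrow> nat) \<Rightarrow> bool" where
  "induced_by R c \<longleftrightarrow>
     R = {(x, y). x < y \<and> c {x, y} = 1} \<union> {(y, x) | x y. x < y \<and> c {x, y} = 0}"

definition tournament :: "(nat \<times> nat) set \<Rightarrow> bool" where
  "tournament R \<longleftrightarrow> (\<exists>c \<in> nsets (UNIV :: nat set) 2 \<rightarrow> {0, 1}. induced_by R c)"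

definition computable_binrel :: "nat set \<Rightarrow> (nat \<times> nat) set \<Rightarrow> bool" where
  "computable_binrel Z R \<longleftrightarrow> computable_rel Z 2 (\<lambda>xs. (xs ! 0, xs ! 1) \<in> R)"

definition transitive_set :: "(nat \<times> nat) set \<Rightarrow> nat set \<Rightarrow> bool" where
  "transitive_set R G \<longleftrightarrow> trans (R \<inter> G \<times> G)"

end

theory Submission
  imports Defs "HOL-Library.Nat_Bijection" "HOL-Library.Countable_Set"
begin

text \<open>
  The set \<open>G\<close> is built by Mathias forcing with conditions \<open>(F, X)\<close>, where the reservoir \<open>X\<close> is such
  that no set \<open>A\<close> that is \<open>\<Delta>\<^sup>0\<^sub>2\<close> but not \<open>\<Sigma>\<^sup>0\<^sub>1\<close> in \<open>Z\<close> becomes \<open>\<Sigma>\<^sup>0\<^sub>1\<close> in \<open>Z \<oplus> X\<close>. To ensure that \<open>A\<close> is not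
  the \<open>e\<close>-th set c.e. in \<open>Z \<oplus> G\<close>, consider the set \<open>B\<close> of all \<open>n\<close> such that every partition of \<open>X\<close>
  into two parts has a part with a finite transitive subset \<open>E\<close> for which \<open>F \<union> E\<close> puts \<open>n\<close> into the
  \<open>e\<close>-th set. By compactness \<open>B\<close> is \<open>\<Sigma>\<^sup>0\<^sub>1\<close> in \<open>Z \<oplus> X\<close>, so \<open>A \<noteq> B\<close>. If \<open>n \<in> B - A\<close>, apply this to the
  partition of an initial segment of \<open>X\<close> into predecessors and successors of infinitely many
  \<open>x \<in> X\<close>, and add the resulting \<open>E\<close> to \<open>F\<close>. If \<open>n \<in> A - B\<close>, the partitions witnessing this form a
  nonempty \<open>\<Pi>\<^sup>0\<^sub>1\<close> class, some member of which preserves that the sets \<open>A\<close> are not \<open>\<Sigma>\<^sup>0\<^sub>1\<close>; an infinite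
  part of it is the new reservoir. Applied to \<open>A\<close> and to its complement, this gives the claim.
\<close>

section \<open>Closure properties of the computable functions\<close>

definition computable_fun :: "nat set \<Rightarrow> nat \<Rightarrow> (nat list \<Rightarrow> nat) \<Rightarrow> bool" where
  "computable_fun W k f \<longleftrightarrow> (\<exists>e. \<forall>xs. length xs = k \<longrightarrow> eval W e xs (f xs))"

named_theorems comp_intros

lemma computable_rel_iff: "computable_rel W k P \<longleftrightarrow> computable_fun W k (\<lambda>xs. if P xs then 1 else 0)"
  by (simp add: computable_rel_def computable_fun_def)

lemma computable_fun_cong:
  "computable_fun W k f \<Longrightarrow> (\<And>xs. length xs = k \<Longrightarrow> f xs = g xs) \<Longrightarrow> computable_fun W k g"
  unfolding computable_fun_def by metis

lemma computable_rel_cong: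
  "computable_rel W k P \<Longrightarrow> (\<And>xs. length xs = k \<Longrightarrow> P xs \<longleftrightarrow> Q xs) \<Longrightarrow> computable_rel W k Q"
  unfolding computable_rel_iff by (erule computable_fun_cong) simp

lemma computable_fun_comp:
  assumes "computable_fun W (length gs) h" "\<And>g. g \<in> set gs \<Longrightarrow> computable_fun W k g"
  shows "computable_fun W k (\<lambda>xs. h (map (\<lambda>g. g xs) gs))"
proof -
  obtain e where e: "\<And>xs. length xs = length gs \<Longrightarrow> eval W e xs (h xs)"
    using assms(1) by (auto simp: computable_fun_def)
  have "\<forall>g\<in>set gs. \<exists>e. \<forall>xs. length xs = k \<longrightarrow> eval W e xs (g xs)"
    using assms(2) by (auto simp: computable_fun_def)
  then obtain p where p: "\<And>g xs. g \<in> set gs \<Longrightarrow> length xs = k \<Longrightarrow> eval W (p g) xs (g xs)"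
    by metis
  have "eval W (Comp e (map p gs)) xs (h (map (\<lambda>g. g xs) gs))" if "length xs = k" for xs
    using that p e by (intro eval_Comp[where ys = "map (\<lambda>g. g xs) gs"]) (auto simp: list_all2_conv_all_nth)
  then show ?thesis by (auto simp: computable_fun_def)
qed

section \<open>Argument lists and substitution\<close>

lemma computable_fun_nth: "i < k \<Longrightarrow> computable_fun W k (\<lambda>xs. xs ! i)"
  unfolding computable_fun_def by (metis eval_Proj)

text \<open>\<open>Comp\<close> takes one program per argument, while argument lists are built below
  with \<open>#\<close>, \<open>tl\<close> and \<open>map\<close>. Lists of a fixed length with
  computable entries mediate between the two.\<close>

definition computable_list :: "nat set \<Rightarrow> nat \<Rightarrow> (nat list \<Rightarrow> nat list) \<Rightarrow> bool" where
  "computable_list W k a \<longleftrightarrow> (\<exists>m. (\<forall>xs. length xs = k \<longrightarrow> length (a xs) = m)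
     \<and> (\<forall>i<m. computable_fun W k (\<lambda>xs. a xs ! i)))"

lemma computable_listE:
  assumes "computable_list W k a"
  obtains m where "\<And>xs. length xs = k \<Longrightarrow> length (a xs) = m"
    "\<And>i. i < m \<Longrightarrow> computable_fun W k (\<lambda>xs. a xs ! i)"
  using assms unfolding computable_list_def by blast

lemma computable_listI:
  "(\<And>xs. length xs = k \<Longrightarrow> length (a xs) = m)
    \<Longrightarrow> (\<And>i. i < m \<Longrightarrow> computable_fun W k (\<lambda>xs. a xs ! i)) \<Longrightarrow> computable_list W k a"
  unfolding computable_list_def by blast

lemma computable_list_id [comp_intros]: "computable_list W k (\<lambda>xs. xs)"
  by (rule computable_listI) (auto simp: computable_fun_nth)

lemma computable_list_Nil [comp_intros]: "computable_list W k (\<lambda>xs. [])"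
  by (rule computable_listI[of _ _ 0]) auto

lemma computable_list_Cons [comp_intros]:
  assumes "computable_fun W k f" "computable_list W k a"
  shows "computable_list W k (\<lambda>xs. f xs # a xs)"
proof -
  obtain m where m: "\<And>xs. length xs = k \<Longrightarrow> length (a xs) = m"
    "\<And>i. i < m \<Longrightarrow> computable_fun W k (\<lambda>xs. a xs ! i)"
    using computable_listE[OF assms(2)] by metis
  have "computable_fun W k (\<lambda>xs. (f xs # a xs) ! i)" if "i < Suc m" for i
    using assms(1) m(2) that by (cases i) auto
  then show ?thesis using m(1) by (intro computable_listI[of _ _ "Suc m"]) auto
qed

lemma computable_list_tl [comp_intros]:
  assumes "computable_list W k a" shows "computable_list W k (\<lambda>xs. tl (a xs))"
proof -
  obtain m where m: "\<And>xs. length xs = k \<Longrightarrow> length (a xs) = m"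
    "\<And>i. i < m \<Longrightarrow> computable_fun W k (\<lambda>xs. a xs ! i)"
    using computable_listE[OF assms] by metis
  have "computable_fun W k (\<lambda>xs. tl (a xs) ! i)" if "i < m - 1" for i
  proof (rule computable_fun_cong)
    show "computable_fun W k (\<lambda>xs. a xs ! Suc i)"
      using m(2) that by simp
  qed (use m(1) that in \<open>simp add: nth_tl\<close>)
  then show ?thesis using m(1) by (intro computable_listI[of _ _ "m - 1"]) auto
qed

lemma computable_list_map [comp_intros]:
  assumes "\<And>g. g \<in> set gs \<Longrightarrow> computable_fun W k (\<lambda>xs. F g xs)"
  shows "computable_list W k (\<lambda>xs. map (\<lambda>g. F g xs) gs)"
  by (rule computable_listI[of _ _ "length gs"]) (use assms in auto)

lemma computable_fun_list_nth [comp_intros]: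
  assumes "computable_list W k a" "\<And>xs. length xs = k \<Longrightarrow> i < length (a xs)"
  shows "computable_fun W k (\<lambda>xs. a xs ! i)"
proof -
  obtain m where m: "\<And>xs. length xs = k \<Longrightarrow> length (a xs) = m"
    "\<And>i. i < m \<Longrightarrow> computable_fun W k (\<lambda>xs. a xs ! i)"
    using computable_listE[OF assms(1)] by metis
  \<comment> \<open>The bound can be read off from any list of length \<open>k\<close>;
    \<open>replicate k 0\<close> serves as one.\<close>
  have "i < m" using m(1)[of "replicate k 0"] assms(2)[of "replicate k 0"] by simp
  then show ?thesis by (rule m(2))
qed

lemma computable_fun_list_hd [comp_intros]:
  assumes "computable_list W k a" and a: "\<And>xs. length xs = k \<Longrightarrow> Suc 0 \<le> length (a xs)"
  shows "computable_fun W k (\<lambda>xs. hd (a xs))"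
proof (rule computable_fun_cong)
  show "computable_fun W k (\<lambda>xs. a xs ! 0)"
    by (rule computable_fun_list_nth[OF assms(1)]) (use a in \<open>simp add: Suc_le_eq\<close>)
qed (use a in \<open>auto simp: Suc_le_eq hd_conv_nth\<close>)

lemma computable_fun_compose:
  assumes "computable_fun W m h" "computable_list W k a"
    and a: "\<And>xs. length xs = k \<Longrightarrow> length (a xs) = m"
  shows "computable_fun W k (\<lambda>xs. h (a xs))"
proof (rule computable_fun_cong)
  \<comment> \<open>The list \<open>a xs\<close> is rebuilt from its entries, the form that
    \<open>Comp\<close> accepts.\<close>
  show "computable_fun W k (\<lambda>xs. h (map (\<lambda>g. g xs) (map (\<lambda>i xs. a xs ! i) [0..<m])))"
    using assms by (intro computable_fun_comp) (auto intro: computable_fun_list_nth)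
  have "map (\<lambda>g. g xs) (map (\<lambda>i xs. a xs ! i) [0..<m]) = a xs" if "length xs = k" for xs
    using a that by (intro nth_equalityI) auto
  then show "h (map (\<lambda>g. g xs) (map (\<lambda>i xs. a xs ! i) [0..<m])) = h (a xs)" if "length xs = k" for xs
    using that by (simp only:)
qed

lemma computable_rel_compose:
  "computable_rel W m P \<Longrightarrow> computable_list W k a
    \<Longrightarrow> (\<And>xs. length xs = k \<Longrightarrow> length (a xs) = m) \<Longrightarrow> computable_rel W k (\<lambda>xs. P (a xs))"
  unfolding computable_rel_iff by (rule computable_fun_compose)

lemma computable_fun_comp1:
  assumes "computable_fun W 1 (\<lambda>xs. h (xs ! 0))" "computable_fun W k f"
  shows "computable_fun W k (\<lambda>xs. h (f xs))"
proof -
  have "computable_list W k (\<lambda>xs. [f xs])" by (intro comp_intros assms)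
  from computable_fun_compose[OF assms(1) this] show ?thesis by simp
qed

lemma computable_fun_comp2:
  assumes "computable_fun W 2 (\<lambda>xs. h (xs ! 0) (xs ! 1))" "computable_fun W k f" "computable_fun W k g"
  shows "computable_fun W k (\<lambda>xs. h (f xs) (g xs))"
proof -
  have "computable_list W k (\<lambda>xs. [f xs, g xs])" by (intro comp_intros assms)
  from computable_fun_compose[OF assms(1) this] show ?thesis by simp
qed

lemma computable_fun_tl:
  assumes "computable_fun W k f" shows "computable_fun W (Suc k) (\<lambda>xs. f (tl xs))"
  by (rule computable_fun_compose[OF assms]) (intro comp_intros, simp)

section \<open>Primitive recursion, case distinction and Boolean connectives\<close>

lemma computable_fun_Suc [comp_intros]:
  assumes "computable_fun W k f" shows "computable_fun W k (\<lambda>xs. Suc (f xs))"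
proof (rule computable_fun_comp1[OF _ assms])
  have "eval W Succ xs (Suc (xs ! 0))" if "length xs = 1" for xs
    using that by (auto simp: length_Suc_conv intro: eval_Succ)
  then show "computable_fun W 1 (\<lambda>xs. Suc (xs ! 0))" by (auto simp: computable_fun_def)
qed

lemma computable_fun_const [comp_intros]: "computable_fun W k (\<lambda>xs. c)"
proof (induction c)
  case 0
  show ?case using eval_Zero by (auto simp: computable_fun_def)
qed (rule computable_fun_Suc)

lemma computable_fun_primrec:
  assumes "computable_fun W k f" "computable_fun W (Suc (Suc k)) g"
  shows "computable_fun W (Suc k) (\<lambda>xs. rec_nat (f (tl xs)) (\<lambda>n r. g (n # r # tl xs)) (hd xs))"
proof -
  obtain p where p: "\<And>xs. length xs = k \<Longrightarrow> eval W p xs (f xs)"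
    using assms(1) by (auto simp: computable_fun_def)
  obtain q where q: "\<And>xs. length xs = Suc (Suc k) \<Longrightarrow> eval W q xs (g xs)"
    using assms(2) by (auto simp: computable_fun_def)
  have "eval W (PrimRec p q) (n # xs) (rec_nat (f xs) (\<lambda>n r. g (n # r # xs)) n)"
    if "length xs = k" for xs n
  proof (induction n)
    case 0
    show ?case using p[OF that] by (auto intro: eval_PrimRec_0)
  next
    case (Suc n)
    then show ?case by (auto intro!: eval_PrimRec_Suc q simp: that)
  qed
  then show ?thesis
    unfolding computable_fun_def by (intro exI[of _ "PrimRec p q"]) (auto simp: length_Suc_conv)
qed

lemma computable_fun_rec_nat:
  assumes "computable_fun W k b" "computable_fun W k f"
    and "computable_fun W (Suc (Suc k)) (\<lambda>xs. g (hd xs) (hd (tl xs)) (tl (tl xs)))"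
  shows "computable_fun W k (\<lambda>xs. rec_nat (f xs) (\<lambda>n r. g n r xs) (b xs))"
proof -
  let ?h = "\<lambda>ys. rec_nat (f (tl ys)) (\<lambda>n r. g n r (tl ys)) (hd ys)"
  have "computable_fun W (Suc k) ?h"
    using computable_fun_primrec[OF assms(2,3)] by simp
  moreover have "computable_list W k (\<lambda>xs. b xs # xs)"
    by (intro comp_intros assms)
  ultimately have "computable_fun W k (\<lambda>xs. ?h (b xs # xs))" by (rule computable_fun_compose) simp
  then show ?thesis by simp
qed

text \<open>Case distinction is a recursion with the truth value of \<open>P\<close> as its bound:
  no step leaves \<open>g xs\<close>, one step overwrites it by \<open>f xs\<close>.\<close>

lemma computable_fun_If [comp_intros]:
  assumes "computable_rel W k P" "computable_fun W k f" "computable_fun W k g"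
  shows "computable_fun W k (\<lambda>xs. if P xs then f xs else g xs)"
proof -
  have "computable_fun W (Suc (Suc k)) (\<lambda>xs. f (tl (tl xs)))"
    by (intro computable_fun_tl assms)
  then have "computable_fun W k (\<lambda>xs. rec_nat (g xs) (\<lambda>n r. f xs) (if P xs then 1 else 0))"
    using assms(1,3) by (intro computable_fun_rec_nat) (auto simp: computable_rel_iff)
  moreover have "rec_nat (g xs) (\<lambda>n r. f xs) (if P xs then 1 else 0) = (if P xs then f xs else g xs)"
    for xs by simp
  ultimately show ?thesis by simp
qed

lemma computable_rel_not [comp_intros]:
  assumes "computable_rel W k P" shows "computable_rel W k (\<lambda>xs. \<not> P xs)"
proof -
  have "computable_fun W k (\<lambda>xs. if P xs then 0 else 1)"
    by (intro comp_intros assms)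
  then show ?thesis unfolding computable_rel_iff by (rule computable_fun_cong) simp
qed

lemma computable_rel_conj [comp_intros]:
  assumes "computable_rel W k P" "computable_rel W k Q"
  shows "computable_rel W k (\<lambda>xs. P xs \<and> Q xs)"
proof -
  have "computable_fun W k (\<lambda>xs. if P xs then if Q xs then 1 else 0 else 0)"
    by (intro comp_intros assms)
  moreover have "(if P xs then if Q xs then 1 else 0 else 0) = (if P xs \<and> Q xs then 1 else (0::nat))"
    for xs by simp
  ultimately show ?thesis by (simp add: computable_rel_iff)
qed

lemma computable_rel_disj [comp_intros]:
  assumes "computable_rel W k P" "computable_rel W k Q"
  shows "computable_rel W k (\<lambda>xs. P xs \<or> Q xs)"
proof -
  have "computable_rel W k (\<lambda>xs. \<not> (\<not> P xs \<and> \<not> Q xs))" by (intro comp_intros assms)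
  then show ?thesis by simp
qed

lemma computable_rel_imp [comp_intros]:
  assumes "computable_rel W k P" "computable_rel W k Q"
  shows "computable_rel W k (\<lambda>xs. P xs \<longrightarrow> Q xs)"
proof -
  have "computable_rel W k (\<lambda>xs. \<not> P xs \<or> Q xs)" by (intro comp_intros assms)
  then show ?thesis by (rule computable_rel_cong) simp
qed

lemma computable_rel_eqv [comp_intros]:
  assumes "computable_rel W k P" "computable_rel W k Q"
  shows "computable_rel W k (\<lambda>xs. P xs \<longleftrightarrow> Q xs)"
proof -
  have "computable_rel W k (\<lambda>xs. (P xs \<longrightarrow> Q xs) \<and> (Q xs \<longrightarrow> P xs))" by (intro comp_intros assms)
  then show ?thesis by (rule computable_rel_cong) blast
qed

section \<open>Arithmetic and order\<close>

lemma computable_rel_eq_0 [comp_intros]: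
  assumes "computable_fun W k f" shows "computable_rel W k (\<lambda>xs. f xs = 0)"
proof -
  have "computable_fun W k (\<lambda>xs. rec_nat 1 (\<lambda>n r. 0) (f xs))"
    by (intro computable_fun_rec_nat comp_intros assms)
  moreover have "rec_nat 1 (\<lambda>n r. 0) m = (if m = 0 then 1 else (0::nat))" for m
    by (cases m) auto
  ultimately show ?thesis by (simp add: computable_rel_iff)
qed

lemma computable_fun_diff [comp_intros]:
  assumes "computable_fun W k f" "computable_fun W k g"
  shows "computable_fun W k (\<lambda>xs. f xs - g xs)"
proof (rule computable_fun_comp2[OF _ assms])
  have pred: "computable_fun W k (\<lambda>xs. f xs - 1)" if "computable_fun W k f" for k f
  proof -
    \<comment> \<open>Returning the recursion index yields the predecessor, with value
      \<open>0\<close> at \<open>0\<close>.\<close>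
    have "computable_fun W k (\<lambda>xs. rec_nat 0 (\<lambda>n r. n) (f xs))"
      by (intro computable_fun_rec_nat comp_intros that) auto
    moreover have "rec_nat 0 (\<lambda>n r. n) m = m - 1" for m
      by (cases m) auto
    ultimately show ?thesis by simp
  qed
  have "computable_fun W 2 (\<lambda>xs. rec_nat (xs ! 0) (\<lambda>n r. r - 1) (xs ! 1))"
    by (intro computable_fun_rec_nat pred comp_intros) auto
  moreover have "rec_nat a (\<lambda>n r. r - 1) m = a - m" for a m :: nat
    by (induction m) auto
  ultimately show "computable_fun W 2 (\<lambda>xs. xs ! 0 - xs ! 1)" by simp
qed

lemma computable_fun_plus [comp_intros]:
  assumes "computable_fun W k f" "computable_fun W k g"
  shows "computable_fun W k (\<lambda>xs. f xs + g xs)"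
proof (rule computable_fun_comp2[OF _ assms])
  have "computable_fun W 2 (\<lambda>xs. rec_nat (xs ! 0) (\<lambda>n r. Suc r) (xs ! 1))"
    by (intro computable_fun_rec_nat comp_intros) auto
  moreover have "rec_nat a (\<lambda>n r. Suc r) m = a + m" for a m :: nat
    by (induction m) auto
  ultimately show "computable_fun W 2 (\<lambda>xs. xs ! 0 + xs ! 1)" by simp
qed

lemma computable_fun_power2 [comp_intros]:
  assumes "computable_fun W k f" shows "computable_fun W k (\<lambda>xs. 2 ^ f xs)"
proof -
  have "computable_fun W k (\<lambda>xs. rec_nat 1 (\<lambda>n r. r + r) (f xs))"
    by (intro computable_fun_rec_nat comp_intros assms) auto
  moreover have "rec_nat 1 (\<lambda>n r. r + r) m = (2::nat) ^ m" for m
    by (induction m) auto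
  ultimately show ?thesis by simp
qed

lemma computable_rel_le [comp_intros]:
  assumes "computable_fun W k f" "computable_fun W k g"
  shows "computable_rel W k (\<lambda>xs. f xs \<le> g xs)"
proof -
  have "computable_rel W k (\<lambda>xs. f xs - g xs = 0)" by (intro comp_intros assms)
  then show ?thesis by simp
qed

lemma computable_rel_less [comp_intros]:
  assumes "computable_fun W k f" "computable_fun W k g"
  shows "computable_rel W k (\<lambda>xs. f xs < g xs)"
proof -
  have "computable_rel W k (\<lambda>xs. \<not> g xs \<le> f xs)" by (intro comp_intros assms)
  then show ?thesis by (simp add: not_le)
qed

lemma computable_rel_eq [comp_intros]:
  assumes "computable_fun W k f" "computable_fun W k g"
  shows "computable_rel W k (\<lambda>xs. f xs = g xs)"
proof -
  have "computable_rel W k (\<lambda>xs. f xs \<le> g xs \<and> g xs \<le> f xs)" by (intro comp_intros assms)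
  then show ?thesis by (simp add: eq_iff)
qed

section \<open>Minimisation, bounded quantifiers and coded finite sets\<close>

lemma computable_fun_Least:
  assumes "computable_rel W (Suc k) (\<lambda>ys. P (hd ys) (tl ys))"
    and ex: "\<And>xs. length xs = k \<Longrightarrow> \<exists>n. P n xs"
  shows "computable_fun W k (\<lambda>xs. LEAST n. P n xs)"
proof -
  \<comment> \<open>\<open>Mu\<close> searches for a zero, so the test is \<open>0\<close> where
    \<open>P\<close> holds; by \<open>ex\<close> the search always ends.\<close>
  have "computable_fun W (Suc k) (\<lambda>ys. if P (hd ys) (tl ys) then 0 else 1)"
    by (intro comp_intros assms)
  then obtain e where "\<And>ys. length ys = Suc k \<Longrightarrow> eval W e ys (if P (hd ys) (tl ys) then 0 else 1)"
    by (auto simp: computable_fun_def)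
  then have e: "eval W e (n # xs) (if P n xs then 0 else 1)" if "length xs = k" for n xs
    using that by (metis length_Cons list.sel(1,3))
  have "eval W (Mu e) xs (LEAST n. P n xs)" if xs: "length xs = k" for xs
  proof (rule eval_Mu)
    have "P (LEAST n. P n xs) xs" using ex[OF xs] by (auto intro: LeastI)
    then show "eval W e ((LEAST n. P n xs) # xs) 0" using e[OF xs] by (metis (full_types))
    show "\<forall>m<LEAST n. P n xs. \<exists>k. eval W e (m # xs) (Suc k)"
      using e[OF xs] not_less_Least by (metis (mono_tags, lifting) One_nat_def)
  qed
  then show ?thesis by (auto simp: computable_fun_def)
qed

text \<open>A search that also stops at the bound \<open>b xs\<close> is total; it stops strictly
  below the bound just when there is a witness.\<close>

lemma computable_rel_bex [comp_intros]:
  assumes P: "computable_rel W (Suc k) (\<lambda>ys. P (hd ys) (tl ys))" and b: "computable_fun W k b"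
  shows "computable_rel W k (\<lambda>xs. \<exists>i<b xs. P i xs)"
proof -
  have "computable_fun W k (\<lambda>xs. LEAST i. b xs \<le> i \<or> P i xs)"
  proof (rule computable_fun_Least)
    show "computable_rel W (Suc k) (\<lambda>ys. b (tl ys) \<le> hd ys \<or> P (hd ys) (tl ys))"
      by (intro comp_intros P computable_fun_tl b) simp
  qed auto
  then have "computable_rel W k (\<lambda>xs. (LEAST i. b xs \<le> i \<or> P i xs) < b xs)"
    by (intro comp_intros b)
  moreover have "(LEAST i. b xs \<le> i \<or> P i xs) < b xs \<longleftrightarrow> (\<exists>i<b xs. P i xs)" for xs
  proof
    assume "\<exists>i<b xs. P i xs"
    then obtain i where "i < b xs" "P i xs" by blast
    moreover have "(LEAST i. b xs \<le> i \<or> P i xs) \<le> i"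
      by (rule Least_le) (use \<open>P i xs\<close> in simp)
    ultimately show "(LEAST i. b xs \<le> i \<or> P i xs) < b xs" by simp
  next
    assume less: "(LEAST i. b xs \<le> i \<or> P i xs) < b xs"
    have "b xs \<le> (LEAST i. b xs \<le> i \<or> P i xs) \<or> P (LEAST i. b xs \<le> i \<or> P i xs) xs"
      by (rule LeastI[of _ "b xs"]) simp
    then show "\<exists>i<b xs. P i xs" using less by auto
  qed
  ultimately show ?thesis by simp
qed

lemma computable_rel_ball [comp_intros]:
  assumes "computable_rel W (Suc k) (\<lambda>ys. P (hd ys) (tl ys))" "computable_fun W k b"
  shows "computable_rel W k (\<lambda>xs. \<forall>i<b xs. P i xs)"
proof -
  have "computable_rel W k (\<lambda>xs. \<not> (\<exists>i<b xs. \<not> P i xs))" by (intro comp_intros assms)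
  then show ?thesis by simp
qed

lemma computable_fun_half [comp_intros]:
  assumes "computable_fun W k f" shows "computable_fun W k (\<lambda>xs. f xs div 2)"
proof -
  \<comment> \<open>Half of \<open>n\<close> is the least \<open>h\<close> with
    \<open>n < 2 * h + 2\<close>, so minimisation replaces division.\<close>
  have "computable_fun W 1 (\<lambda>xs. LEAST h. xs ! 0 < Suc (Suc (h + h)))"
  proof (rule computable_fun_Least)
    show "\<exists>n. xs ! 0 < Suc (Suc (n + n))" for xs :: "nat list" by (rule exI[of _ "xs ! 0"]) simp
  qed (intro comp_intros; simp)
  moreover have "(LEAST h. n < Suc (Suc (h + h))) = n div 2" for n :: nat
    by (rule Least_equality) auto
  ultimately have "computable_fun W 1 (\<lambda>xs. xs ! 0 div 2)" by simp
  then show ?thesis using assms by (rule computable_fun_comp1)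
qed

lemma computable_rel_even [comp_intros]:
  assumes "computable_fun W k f" shows "computable_rel W k (\<lambda>xs. even (f xs))"
proof -
  have "computable_rel W k (\<lambda>xs. f xs div 2 + f xs div 2 = f xs)" by (intro comp_intros assms)
  moreover have "n div 2 + n div 2 = n \<longleftrightarrow> even n" for n :: nat by presburger
  ultimately show ?thesis by simp
qed

text \<open>The relevant bit of the code is reached by halving \<open>f xs\<close> times.\<close>

lemma computable_rel_set_decode [comp_intros]:
  assumes "computable_fun W k f" "computable_fun W k g"
  shows "computable_rel W k (\<lambda>xs. f xs \<in> set_decode (g xs))"
proof -
  have "computable_fun W k (\<lambda>xs. rec_nat (g xs) (\<lambda>n r. r div 2) (f xs))"
    by (intro computable_fun_rec_nat comp_intros assms) auto
  moreover have "rec_nat a (\<lambda>n r. r div 2) m = a div 2 ^ m" for a m :: nat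
    by (induction m) (auto simp: div_mult2_eq[symmetric] mult.commute)
  ultimately have "computable_fun W k (\<lambda>xs. g xs div 2 ^ f xs)" by simp
  then show ?thesis unfolding set_decode_def mem_Collect_eq by (intro comp_intros)
qed

section \<open>Oracle queries and joins\<close>

lemma computable_rel_oracle:
  assumes "computable_fun W k f" shows "computable_rel W k (\<lambda>xs. f xs \<in> W)"
proof -
  have "eval W Query xs (if xs ! 0 \<in> W then 1 else 0)" if "length xs = 1" for xs
    using that eval_Query[of W "xs ! 0"] by (cases xs) auto
  then have "computable_fun W 1 (\<lambda>xs. if xs ! 0 \<in> W then 1 else 0)"
    unfolding computable_fun_def by blast
  from computable_fun_comp1[OF this assms] show ?thesis by (simp add: computable_rel_iff)
qed

lemma join_iff: "x \<in> A \<oplus> B \<longleftrightarrow> (if even x then x div 2 \<in> A else x div 2 \<in> B)"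
  unfolding join_def by auto

lemma computable_rel_join [comp_intros]:
  assumes "computable_fun W k f"
    and "computable_rel W k (\<lambda>xs. f xs div 2 \<in> A xs)" "computable_rel W k (\<lambda>xs. f xs div 2 \<in> B xs)"
  shows "computable_rel W k (\<lambda>xs. f xs \<in> A xs \<oplus> B xs)"
proof -
  have "computable_rel W k (\<lambda>xs. (even (f xs) \<and> f xs div 2 \<in> A xs) \<or> (\<not> even (f xs) \<and> f xs div 2 \<in> B xs))"
    by (intro comp_intros assms)
  then show ?thesis unfolding join_iff by (rule computable_rel_cong) auto
qed

lemma computable_rel_join_components:
  assumes "computable_fun (X \<oplus> Y) k f"
  shows "computable_rel (X \<oplus> Y) k (\<lambda>xs. f xs \<in> X)" "computable_rel (X \<oplus> Y) k (\<lambda>xs. f xs \<in> Y)"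
proof -
  have "computable_rel (X \<oplus> Y) k (\<lambda>xs. f xs + f xs \<in> X \<oplus> Y)"
    "computable_rel (X \<oplus> Y) k (\<lambda>xs. Suc (f xs + f xs) \<in> X \<oplus> Y)"
    by (intro computable_rel_oracle comp_intros assms)+
  then show "computable_rel (X \<oplus> Y) k (\<lambda>xs. f xs \<in> X)" "computable_rel (X \<oplus> Y) k (\<lambda>xs. f xs \<in> Y)"
    by (auto simp: join_iff mult_2[symmetric])
qed

section \<open>Relative computability\<close>

text \<open>Turing reducibility of \<open>Y\<close> to \<open>W\<close>.\<close>

definition reducible :: "nat set \<Rightarrow> nat set \<Rightarrow> bool" where
  "reducible Y W \<longleftrightarrow> computable_rel W 1 (\<lambda>xs. xs ! 0 \<in> Y)"

text \<open>Each oracle query becomes a call of \<open>q\<close>, which is meant to decide the old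
  oracle from the new one; this gives transitivity of Turing reducibility.\<close>

fun relativize :: "prog \<Rightarrow> prog \<Rightarrow> prog" where
  "relativize q Query = q"
| "relativize q (Comp f gs) = Comp (relativize q f) (map (relativize q) gs)"
| "relativize q (PrimRec f g) = PrimRec (relativize q f) (relativize q g)"
| "relativize q (Mu f) = Mu (relativize q f)"
| "relativize q e = e"

lemma eval_relativize:
  assumes "eval Y e xs y" "\<And>n. eval W q [n] (if n \<in> Y then 1 else 0)"
  shows "eval W (relativize q e) xs y"
  using assms(1)
proof (induction rule: eval.induct)
  case (eval_Comp xs gs ys f z)
  then show ?case
    by (auto intro!: eval.eval_Comp[of _ _ _ ys] simp: list_all2_conv_all_nth)
next
  case (eval_Mu f n xs)
  then show ?case by (auto intro!: eval.eval_Mu)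
next
  case (eval_Query n)
  then show ?case using assms(2) by simp
next
  case (eval_PrimRec_Suc f g n xs r y)
  then show ?case by simp (rule eval.eval_PrimRec_Suc)
qed (auto intro: eval_Zero eval_Succ eval_Proj eval_PrimRec_0)

lemma reducible_computable_fun:
  assumes "reducible Y W" "computable_fun Y k f" shows "computable_fun W k f"
proof -
  obtain q where "\<And>xs. length xs = 1 \<Longrightarrow> eval W q xs (if xs ! 0 \<in> Y then 1 else 0)"
    using assms(1) by (auto simp: reducible_def computable_rel_def)
  then have "eval W q [n] (if n \<in> Y then 1 else 0)" for n by (metis One_nat_def length_Cons list.size(3) nth_Cons_0)
  then show ?thesis using assms(2) eval_relativize unfolding computable_fun_def by metis
qed

lemma reducible_computable_rel:
  "reducible Y W \<Longrightarrow> computable_rel Y k P \<Longrightarrow> computable_rel W k P"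
  unfolding computable_rel_iff by (rule reducible_computable_fun)

lemma reducible_Sigma01: "reducible Y W \<Longrightarrow> Sigma01 Y A \<Longrightarrow> Sigma01 W A"
  unfolding Sigma01_def using reducible_computable_rel by blast

lemma reducible_Delta02: "reducible Y W \<Longrightarrow> Delta02 Y A \<Longrightarrow> Delta02 W A"
  unfolding Delta02_def Sigma02_def Pi02_def using reducible_computable_rel by blast

lemma reducible_mem:
  assumes "reducible Y W" "computable_fun W k f" shows "computable_rel W k (\<lambda>xs. f xs \<in> Y)"
  using computable_fun_comp1[of W "\<lambda>n. if n \<in> Y then 1 else 0", OF _ assms(2)] assms(1)
  by (simp add: reducible_def computable_rel_iff)

lemma reducible_join:
  assumes "reducible X W" "reducible Y W" shows "reducible (X \<oplus> Y) W"
  unfolding reducible_def by (intro comp_intros reducible_mem assms) simp_all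

lemma reducible_join_left: "reducible X (X \<oplus> Y)"
  unfolding reducible_def by (intro computable_rel_join_components comp_intros) simp

lemma reducible_join_right: "reducible Y (X \<oplus> Y)"
  unfolding reducible_def by (intro computable_rel_join_components comp_intros) simp

lemma reducible_refl: "reducible X X"
  unfolding reducible_def by (intro computable_rel_oracle comp_intros) simp

lemma reducible_trans: "reducible X Y \<Longrightarrow> reducible Y W \<Longrightarrow> reducible X W"
  unfolding reducible_def[of X] by (rule reducible_computable_rel)

section \<open>Step-bounded evaluation\<close>

text \<open>As \<open>gs\<close> is fixed, this is a finite disjunction; it serves the clause of
  \<open>appr\<close> for \<open>Comp\<close>.\<close>

lemma computable_rel_list_bex:
  assumes "\<And>g. g \<in> set gs \<Longrightarrow> computable_rel W k (P g)"
  shows "computable_rel W k (\<lambda>xs. \<exists>g\<in>set gs. P g xs)"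
  using assms
proof (induction gs)
  case Nil
  have "computable_rel W k (\<lambda>xs. Suc 0 = 0)" by (intro comp_intros)
  then show ?case by simp
next
  case (Cons g gs)
  then have "computable_rel W k (\<lambda>xs. P g xs \<or> (\<exists>g\<in>set gs. P g xs))"
    by (intro comp_intros) auto
  then show ?case by simp
qed

text \<open>\<open>appr V s e xs\<close> evaluates \<open>e\<close> with all searches and oracle queries bounded by \<open>s\<close>. The value
  \<open>0\<close> means that no output was found, \<open>Suc y\<close> stands for the output \<open>y\<close>.\<close>

fun appr :: "nat set \<Rightarrow> nat \<Rightarrow> prog \<Rightarrow> nat list \<Rightarrow> nat" where
  "appr V s Zero xs = 1"
| "appr V s Succ xs = (if length xs = 1 then Suc (Suc (xs ! 0)) else 0)"
| "appr V s (Proj i) xs = (if i < length xs then Suc (xs ! i) else 0)"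
| "appr V s Query xs =
    (if length xs = 1 \<and> xs ! 0 < s then if xs ! 0 \<in> V then 2 else 1 else 0)"
| "appr V s (Comp f gs) xs =
    (if \<exists>g\<in>set gs. appr V s g xs = 0 then 0 else appr V s f (map (\<lambda>g. appr V s g xs - 1) gs))"
| "appr V s (PrimRec f g) xs =
    (if xs = [] then 0
     else rec_nat (appr V s f (tl xs))
       (\<lambda>n r. if r = 0 then 0 else appr V s g (n # (r - 1) # tl xs)) (hd xs))"
| "appr V s (Mu f) xs =
    (let m = (LEAST m. s \<le> m \<or> appr V s f (m # xs) \<le> 1)
     in if m < s \<and> appr V s f (m # xs) = 1 then Suc m else 0)"

text \<open>The use principle: only \<open>Query\<close> looks at the oracle, and it answers only
  below \<open>s\<close>.\<close>

lemma appr_cong: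
  assumes "V \<inter> {..<s} = V' \<inter> {..<s}" shows "appr V s e xs = appr V' s e xs"
proof (induction e arbitrary: xs)
  case (Comp f gs)
  then show ?case by (auto cong: map_cong)
next
  case Query
  have "q \<in> V \<longleftrightarrow> q \<in> V'" if "q < s" for q using assms that by auto
  then show ?case by simp
next
  case (PrimRec f g)
  then show ?case by (simp only: appr.simps)
qed simp_all

lemma appr_PrimRec_0: "appr V s (PrimRec f g) (0 # xs) = appr V s f xs"
  and appr_PrimRec_Suc: "appr V s (PrimRec f g) (Suc n # xs) =
    (if appr V s (PrimRec f g) (n # xs) = 0 then 0
     else appr V s g (n # (appr V s (PrimRec f g) (n # xs) - 1) # xs))"
  unfolding appr.simps list.sel by simp_all

text \<open>Exhausted bounds show up as the value \<open>0\<close>, which is passed on, so a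
  positive value comes from a genuine computation.\<close>

lemma appr_sound: "appr V s e xs = Suc y \<Longrightarrow> eval V e xs y"
proof (induction e arbitrary: xs y)
  case Zero
  then show ?case by (simp add: eval_Zero)
next
  case Succ
  then show ?case by (cases xs) (auto simp: eval_Succ split: if_splits)
next
  case (Proj i)
  then show ?case by (auto simp: eval_Proj split: if_splits)
next
  case Query
  then show ?case using eval_Query[of V "hd xs"] by (cases xs) (auto split: if_splits)
next
  case (Comp f gs)
  let ?ys = "map (\<lambda>g. appr V s g xs - 1) gs"
  have nz: "\<forall>g\<in>set gs. appr V s g xs \<noteq> 0" and f: "appr V s f ?ys = Suc y"
    using Comp.prems by (auto split: if_splits)
  have "eval V g xs (appr V s g xs - 1)" if "g \<in> set gs" for g
    using Comp.IH(2)[OF that] nz that by simp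
  then have "list_all2 (\<lambda>g y. eval V g xs y) gs ?ys"
    by (simp add: list_all2_conv_all_nth)
  then show ?case using Comp.IH(1)[OF f] by (rule eval_Comp)
next
  case (PrimRec f g)
  then obtain n ys where xs: "xs = n # ys" by (cases xs) auto
  have "eval V (PrimRec f g) (n # ys) z" if "appr V s (PrimRec f g) (n # ys) = Suc z" for z
    using that
  proof (induction n arbitrary: z)
    case 0
    then show ?case unfolding appr_PrimRec_0 by (intro eval_PrimRec_0 PrimRec.IH)
  next
    case (Suc n)
    let ?r = "appr V s (PrimRec f g) (n # ys)"
    have "?r \<noteq> 0" and g: "appr V s g (n # (?r - 1) # ys) = Suc z"
      using Suc.prems unfolding appr_PrimRec_Suc by (auto simp del: appr.simps split: if_splits)
    then have r: "?r = Suc (?r - 1)" by simp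
    show ?case using Suc.IH[OF r] PrimRec.IH(2)[OF g] by (rule eval_PrimRec_Suc)
  qed
  then show ?case using PrimRec.prems xs by blast
next
  case (Mu f)
  define m where "m = (LEAST m. s \<le> m \<or> appr V s f (m # xs) \<le> 1)"
  have m: "m < s" "appr V s f (m # xs) = 1" "y = m"
    using Mu.prems unfolding appr.simps Let_def m_def[symmetric] by (auto split: if_splits)
  \<comment> \<open>Below \<open>m\<close> the value of \<open>appr\<close> is at least
    \<open>2\<close>, which means a positive output, as \<open>eval_Mu\<close> requires.\<close>
  have "eval V f (i # xs) (Suc (appr V s f (i # xs) - 2))" if "i < m" for i
  proof (rule Mu.IH)
    have "\<not> (s \<le> i \<or> appr V s f (i # xs) \<le> 1)" using not_less_Least that unfolding m_def by blast
    then show "appr V s f (i # xs) = Suc (Suc (appr V s f (i # xs) - 2))" by linarith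
  qed
  moreover have "eval V f (m # xs) 0" using m by (intro Mu.IH) simp
  ultimately show ?case unfolding m(3) by (intro eval_Mu) auto
qed

text \<open>A halting computation makes finitely many queries and searches, so all large bounds
  suffice. The eventual form lets finitely many subcomputations share one bound.\<close>

lemma appr_complete: "eval V e xs y \<Longrightarrow> \<forall>\<^sub>F s in sequentially. appr V s e xs = Suc y"
proof (induction rule: eval.induct)
  case (eval_Query n)
  show ?case using eventually_gt_at_top[of n] by eventually_elim simp
next
  case (eval_Comp xs gs ys f z)
  have len: "length gs = length ys" using eval_Comp.IH(1) by (simp add: list_all2_lengthD)
  have "\<forall>\<^sub>F s in sequentially. \<forall>i\<in>{..<length gs}. appr V s (gs ! i) xs = Suc (ys ! i)"
    by (rule eventually_ball_finite) (use eval_Comp.IH(1) in \<open>auto simp: list_all2_conv_all_nth\<close>)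
  then show ?case using eval_Comp.IH(2)
  proof eventually_elim
    case (elim s)
    have "map (\<lambda>g. appr V s g xs - 1) gs = ys"
      using elim(1) len by (intro nth_equalityI) auto
    moreover have "\<forall>g\<in>set gs. appr V s g xs \<noteq> 0"
      using elim(1) by (auto simp: in_set_conv_nth)
    ultimately show ?case using elim(2) by simp
  qed
next
  case (eval_PrimRec_Suc f g n xs r y)
  from eval_PrimRec_Suc.IH show ?case
    by eventually_elim (simp add: appr_PrimRec_Suc del: appr.simps)
next
  case (eval_Mu f n xs)
  have "\<forall>\<^sub>F s in sequentially. \<forall>m\<in>{..<n}. \<exists>k. appr V s f (m # xs) = Suc (Suc k)"
  proof (rule eventually_ball_finite)
    show "\<forall>m\<in>{..<n}. \<forall>\<^sub>F s in sequentially. \<exists>k. appr V s f (m # xs) = Suc (Suc k)"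
      using eval_Mu.IH(2) by (fastforce elim: eventually_mono)
  qed simp
  with eval_Mu.IH(1) eventually_gt_at_top[of n] show ?case
  proof eventually_elim
    case (elim s)
    \<comment> \<open>Before \<open>n\<close> all outputs are positive, so the values are at least
      \<open>2\<close> and the search does not stop there; nor does the bound stop it, as
      \<open>n < s\<close>.\<close>
    have "(LEAST m. s \<le> m \<or> appr V s f (m # xs) \<le> 1) = n"
    proof (rule Least_equality)
      fix m assume m: "s \<le> m \<or> appr V s f (m # xs) \<le> 1"
      show "n \<le> m"
      proof (rule ccontr)
        assume "\<not> n \<le> m"
        then obtain k where "appr V s f (m # xs) = Suc (Suc k)"
          using elim(3) by (meson lessThan_iff not_le)
        with m \<open>\<not> n \<le> m\<close> elim(2) show False by simp
      qed
    qed (use elim in simp)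
    then show ?case using elim by simp
  qed
qed simp_all

lemma computable_list_compose_tl:
  assumes "computable_list W k a" shows "computable_list W (Suc k) (\<lambda>xs. a (tl xs))"
proof -
  obtain m where m: "\<And>xs. length xs = k \<Longrightarrow> length (a xs) = m"
    "\<And>i. i < m \<Longrightarrow> computable_fun W k (\<lambda>xs. a xs ! i)"
    using computable_listE[OF assms] by metis
  then show ?thesis by (intro computable_listI[of _ _ m] computable_fun_tl) auto
qed

text \<open>Bounded evaluation always ends, so it is computable even when the oracle varies with a
  parameter \<open>c\<close>; below, \<open>c\<close> codes a finite part of an oracle. Arity and
  arguments are general because recursion and search change the argument list.\<close>

lemma computable_fun_appr:
  assumes V: "computable_rel W 2 (\<lambda>xs. xs ! 0 \<in> V (xs ! 1))"
  shows "computable_fun W k s \<Longrightarrow> computable_fun W k c \<Longrightarrow> computable_list W k a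
    \<Longrightarrow> computable_fun W k (\<lambda>xs. appr (V (c xs)) (s xs) e (a xs))"
proof (induction e arbitrary: k s c a)
  case Zero
  show ?case unfolding appr.simps by (rule comp_intros)
next
  case Succ
  obtain m where m: "\<And>xs. length xs = k \<Longrightarrow> length (a xs) = m"
    using computable_listE[OF Succ(3)] by metis
  show ?case
  proof (cases "m = 1")
    case True
    have "computable_fun W k (\<lambda>xs. Suc (Suc (a xs ! 0)))"
      by (intro comp_intros Succ) (simp add: m True)
    then show ?thesis by (rule computable_fun_cong) (simp add: m True)
  next
    case False
    show ?thesis by (rule computable_fun_cong[OF computable_fun_const[of _ _ 0]]) (use False in \<open>simp add: m\<close>)
  qed
next
  case (Proj i)
  obtain m where m: "\<And>xs. length xs = k \<Longrightarrow> length (a xs) = m"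
    using computable_listE[OF Proj(3)] by metis
  show ?case
  proof (cases "i < m")
    case True
    have "computable_fun W k (\<lambda>xs. Suc (a xs ! i))"
      by (intro comp_intros Proj) (simp add: m True)
    then show ?thesis by (rule computable_fun_cong) (simp add: m True)
  next
    case False
    show ?thesis by (rule computable_fun_cong[OF computable_fun_const[of _ _ 0]]) (use False in \<open>simp add: m\<close>)
  qed
next
  case Query
  obtain m where m: "\<And>xs. length xs = k \<Longrightarrow> length (a xs) = m"
    using computable_listE[OF Query(3)] by metis
  show ?case
  proof (cases "m = 1")
    case True
    have "computable_list W k (\<lambda>xs. [a xs ! 0, c xs])"
      by (intro comp_intros Query) (simp add: m True)
    from computable_rel_compose[OF V this]
    have "computable_rel W k (\<lambda>xs. a xs ! 0 \<in> V (c xs))" by simp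
    then have "computable_fun W k
        (\<lambda>xs. if a xs ! 0 < s xs then if a xs ! 0 \<in> V (c xs) then 2 else 1 else 0)"
      by (intro comp_intros Query) (simp_all add: m True)
    then show ?thesis by (rule computable_fun_cong) (simp add: m True)
  next
    case False
    show ?thesis by (rule computable_fun_cong[OF computable_fun_const[of _ _ 0]]) (use False in \<open>simp add: m\<close>)
  qed
next
  case (Comp f gs)
  have g: "computable_fun W k (\<lambda>xs. appr (V (c xs)) (s xs) g (a xs))" if "g \<in> set gs" for g
    using that Comp.prems by (rule Comp.IH(2))
  show ?case unfolding appr.simps
    by (intro comp_intros computable_rel_list_bex g Comp.IH(1) Comp.prems)
next
  case (PrimRec f g)
  obtain m where m: "\<And>xs. length xs = k \<Longrightarrow> length (a xs) = m"
    using computable_listE[OF PrimRec.prems(3)] by metis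
  show ?case
  proof (cases "m = 0")
    case True
    show ?thesis
      by (rule computable_fun_cong[OF computable_fun_const[of _ _ 0]]) (use m True in auto)
  next
    case False
    have "computable_fun W k (\<lambda>xs. rec_nat (appr (V (c xs)) (s xs) f (tl (a xs)))
       (\<lambda>n r. if r = 0 then 0 else appr (V (c xs)) (s xs) g (n # (r - 1) # tl (a xs))) (hd (a xs)))"
      by (intro computable_fun_rec_nat comp_intros PrimRec.IH PrimRec.prems
          computable_fun_tl computable_list_compose_tl) (use m False in simp_all)
    then show ?thesis by (rule computable_fun_cong) (use m False in auto)
  qed
next
  case (Mu f)
  have "computable_fun W k (\<lambda>xs. LEAST m. s xs \<le> m \<or> appr (V (c xs)) (s xs) f (m # a xs) \<le> 1)"
    (is "computable_fun W k ?m")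
  proof (rule computable_fun_Least)
    show "computable_rel W (Suc k)
        (\<lambda>ys. s (tl ys) \<le> hd ys \<or> appr (V (c (tl ys))) (s (tl ys)) f (hd ys # a (tl ys)) \<le> 1)"
      by (intro comp_intros Mu.IH computable_fun_tl computable_list_compose_tl Mu.prems) simp_all
  qed auto
  then show ?case unfolding appr.simps Let_def
    by (intro comp_intros Mu.IH Mu.prems)
qed

definition ce_set :: "nat set \<Rightarrow> prog \<Rightarrow> nat set" where
  "ce_set V e = {n. \<exists>y. eval V e [n, y] 1}"

text \<open>The stage \<open>s\<close> bounds the witness, the searches and the use of the oracle at
  once. The value \<open>2\<close> of \<open>appr\<close> stands for the output
  \<open>1\<close>.\<close>

definition enters_by :: "nat set \<Rightarrow> nat \<Rightarrow> prog \<Rightarrow> nat \<Rightarrow> bool" where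
  "enters_by V s e n \<longleftrightarrow> (\<exists>y<s. appr V s e [n, y] = 2)"

lemma ce_set_iff: "n \<in> ce_set V e \<longleftrightarrow> (\<exists>s. enters_by V s e n)"
proof
  assume "n \<in> ce_set V e"
  then obtain y where "eval V e [n, y] 1" by (auto simp: ce_set_def)
  from appr_complete[OF this] have "\<forall>\<^sub>F s in sequentially. y < s \<and> appr V s e [n, y] = Suc 1"
    using eventually_gt_at_top[of y] by eventually_elim simp
  from eventually_happens[OF this] show "\<exists>s. enters_by V s e n"
    by (auto simp: enters_by_def eval_nat_numeral)
qed (auto simp: enters_by_def ce_set_def numeral_2_eq_2 intro: appr_sound)

lemma enters_by_cong:
  "V \<inter> {..<s} = V' \<inter> {..<s} \<Longrightarrow> enters_by V s e n \<longleftrightarrow> enters_by V' s e n"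
  unfolding enters_by_def using appr_cong by metis

lemma computable_rel_enters_by:
  assumes V: "computable_rel W 2 (\<lambda>xs. xs ! 0 \<in> V (xs ! 1))"
    and "computable_fun W k s" "computable_fun W k c" "computable_fun W k f"
  shows "computable_rel W k (\<lambda>xs. enters_by (V (c xs)) (s xs) e (f xs))"
  unfolding enters_by_def
  by (intro comp_intros computable_fun_appr[OF V] computable_fun_tl assms) simp

lemma Sigma01_imp_ce_set:
  assumes "Sigma01 V A" obtains e where "A = ce_set V e"
proof -
  obtain P where P: "computable_rel V 2 P" "A = {x. \<exists>y. P [x, y]}"
    using assms by (auto simp: Sigma01_def)
  from P(1) obtain e where "\<And>x y. eval V e [x, y] (if P [x, y] then 1 else 0)"
    unfolding computable_rel_def by (metis One_nat_def Suc_1 length_Cons list.size(3))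
  then have "P [x, y] \<longleftrightarrow> eval V e [x, y] 1" for x y
    by (metis eval_functional zero_neq_one)
  then show ?thesis using that[of e] P(2) by (simp add: ce_set_def)
qed

section \<open>Compactness and effectively closed classes\<close>

text \<open>Makes \<open>{Y. \<exists>s. q Y s}\<close> open in Cantor space, with the stage
  doubling as a bound on the use.\<close>

definition finite_use :: "(nat set \<Rightarrow> nat \<Rightarrow> bool) \<Rightarrow> bool" where
  "finite_use q \<longleftrightarrow> (\<forall>Y s. q (Y \<inter> {..<s}) s \<longleftrightarrow> q Y s)"

lemma finite_useD:
  assumes "finite_use q" "Y \<inter> {..<s} = Y' \<inter> {..<s}" shows "q Y s \<longleftrightarrow> q Y' s"
  using assms unfolding finite_use_def by metis

lemma finite_useI:
  assumes "\<And>Y Y' s. Y \<inter> {..<s} = Y' \<inter> {..<s} \<Longrightarrow> q Y s \<Longrightarrow> q Y' s" shows "finite_use q"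
  unfolding finite_use_def
proof (intro allI)
  fix Y :: "nat set" and s
  have "Y \<inter> {..<s} \<inter> {..<s} = Y \<inter> {..<s}" by blast
  then show "q (Y \<inter> {..<s}) s \<longleftrightarrow> q Y s" using assms by metis
qed

text \<open>Koenig's lemma: if \<open>U s\<close> avoids \<open>q\<close> at all stages below
  \<open>s\<close>, then a limit of prefixes shared by infinitely many \<open>U s\<close> avoids
  \<open>q\<close> at all stages.\<close>

lemma cantor_space_compact:
  assumes "finite_use q" and Y: "\<And>s. \<exists>Y. \<forall>t<s. \<not> q Y t"
  shows "\<exists>Y. \<forall>t. \<not> q Y t"
proof -
  obtain U where U: "\<And>s t. t < s \<Longrightarrow> \<not> q (U s) t" using Y by metis
  \<comment> \<open>\<open>P k\<close> is a prefix of length \<open>k\<close> shared by infinitely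
    many \<open>U s\<close>; so is one of its two extensions by a bit.\<close>
  have "\<exists>P. \<forall>k. (P k \<subseteq> {..<k} \<and> infinite {s. U s \<inter> {..<k} = P k}) \<and> P (Suc k) \<inter> {..<k} = P k"
  proof (rule dependent_nat_choice)
    show "\<exists>x. x \<subseteq> {..<0} \<and> infinite {s. U s \<inter> {..<0} = x}" by (intro exI[of _ "{}"]) simp
  next
    fix x :: "nat set" and k
    assume x: "x \<subseteq> {..<k} \<and> infinite {s. U s \<inter> {..<k} = x}"
    have k: "k \<notin> x" using x by auto
    have "U s \<inter> {..<k} = x \<longleftrightarrow> U s \<inter> {..<Suc k} = x \<or> U s \<inter> {..<Suc k} = insert k x" for s
      unfolding lessThan_Suc using x k by (cases "k \<in> U s") auto
    then have "{s. U s \<inter> {..<k} = x} = {s. U s \<inter> {..<Suc k} = x} \<union> {s. U s \<inter> {..<Suc k} = insert k x}"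
      by blast
    then have "infinite {s. U s \<inter> {..<Suc k} = x} \<or> infinite {s. U s \<inter> {..<Suc k} = insert k x}"
      using x by simp
    then show "\<exists>y. (y \<subseteq> {..<Suc k} \<and> infinite {s. U s \<inter> {..<Suc k} = y}) \<and> y \<inter> {..<k} = x"
    proof
      assume "infinite {s. U s \<inter> {..<Suc k} = x}"
      then show ?thesis using x by (intro exI[of _ x]) auto
    next
      assume "infinite {s. U s \<inter> {..<Suc k} = insert k x}"
      then show ?thesis using x by (intro exI[of _ "insert k x"]) auto
    qed
  qed
  then obtain P where P: "\<And>k. P k \<subseteq> {..<k}" "\<And>k. infinite {s. U s \<inter> {..<k} = P k}"
    "\<And>k. P (Suc k) \<inter> {..<k} = P k" by blast
  have P_mono: "P m \<inter> {..<k} = P k" if "k \<le> m" for k m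
    using that
  proof (induction m rule: dec_induct)
    case base
    show ?case using P(1) by blast
  next
    case (step m)
    have "P (Suc m) \<inter> {..<k} = P (Suc m) \<inter> {..<m} \<inter> {..<k}" using step(1) by auto
    then show ?case using step P(3) by simp
  qed
  define Y where "Y = (\<Union>k. P k)"
  have Y: "Y \<inter> {..<k} = P k" for k
  proof
    show "Y \<inter> {..<k} \<subseteq> P k"
    proof
      fix x assume "x \<in> Y \<inter> {..<k}"
      then obtain m where "x \<in> P m" "x < k" by (auto simp: Y_def)
      then have "x \<in> P (max k m)" using P_mono[of m "max k m"] by auto
      then show "x \<in> P k" using P_mono[of k "max k m"] \<open>x < k\<close> by auto
    qed
    show "P k \<subseteq> Y \<inter> {..<k}" using P(1) by (auto simp: Y_def)
  qed
  have "\<not> q Y t" for t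
  proof -
    \<comment> \<open>At stage \<open>t\<close> only the first \<open>t\<close> bits are read, and
      there \<open>Y\<close> agrees with some \<open>U s\<close> for which
      \<open>t < s\<close>.\<close>
    obtain s where s: "s > t" "U s \<inter> {..<t} = P t"
      using P(2)[of t] by (auto simp: infinite_nat_iff_unbounded)
    then show ?thesis using finite_useD[OF assms(1)] Y U by metis
  qed
  then show ?thesis by blast
qed

lemma finite_use_cover:
  assumes "finite_use q" and cover: "\<forall>Y. \<exists>s. q Y s"
  shows "\<exists>s. \<forall>Y. \<exists>t<s. q Y t"
proof (rule ccontr)
  assume "\<not> (\<exists>s. \<forall>Y. \<exists>t<s. q Y t)"
  then have "\<exists>Y. \<forall>t. \<not> q Y t" by (intro cantor_space_compact assms(1)) simp
  then show False using cover by blast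
qed

text \<open>\<open>effective W q\<close> makes \<open>n \<mapsto> {Y. \<exists>s. q n Y s}\<close> a uniformly \<open>W\<close>-c.e. sequence of open subsets
  of Cantor space: \<open>q n Y s\<close> looks at \<open>Y\<close> only below \<open>s\<close>, and is decided by \<open>W\<close> from a code
  for \<open>Y \<inter> {..<s}\<close>.\<close>

definition effective :: "nat set \<Rightarrow> (nat \<Rightarrow> nat set \<Rightarrow> nat \<Rightarrow> bool) \<Rightarrow> bool" where
  "effective W q \<longleftrightarrow> (\<forall>n. finite_use (q n)) \<and>
     computable_rel W 3 (\<lambda>xs. q (xs ! 0) (set_decode (xs ! 1)) (xs ! 2))"

lemma effectiveD:
  assumes "effective W q" "computable_fun W k f" "computable_fun W k g" "computable_fun W k h"
  shows "computable_rel W k (\<lambda>xs. q (f xs) (set_decode (g xs)) (h xs))"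
proof -
  have "computable_list W k (\<lambda>xs. [f xs, g xs, h xs])" by (intro comp_intros assms)
  from computable_rel_compose[OF assms(1)[unfolded effective_def, THEN conjunct2] this] show ?thesis
    by simp
qed

lemma effective_disj:
  assumes "effective W p" "effective W q" shows "effective W (\<lambda>n Y s. p n Y s \<or> q n Y s)"
proof -
  have "finite_use (\<lambda>Y s. p n Y s \<or> q n Y s)" for n
    using assms unfolding effective_def finite_use_def by simp
  moreover have "computable_rel W 3 (\<lambda>xs. p (xs ! 0) (set_decode (xs ! 1)) (xs ! 2) \<or> q (xs ! 0) (set_decode (xs ! 1)) (xs ! 2))"
    by (intro comp_intros effectiveD assms) simp_all
  ultimately show ?thesis by (simp add: effective_def)
qed

text \<open>Freezing the index singles out one class of the sequence, in the format that
  \<open>Pi01_class_avoiding\<close> expects.\<close>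

lemma effective_const:
  assumes "effective W q" shows "effective W (\<lambda>_. q n)"
proof -
  have "computable_rel W 3 (\<lambda>xs. q n (set_decode (xs ! 1)) (xs ! 2))"
    by (intro comp_intros effectiveD assms) simp_all
  then show ?thesis using assms by (simp add: effective_def)
qed

text \<open>A query \<open>x < s\<close> to the join reads \<open>Y\<close> only at
  \<open>x div 2\<close>, which is below \<open>s\<close> too.\<close>

lemma enters_by_join_cong:
  assumes "Y \<inter> {..<s} = Y' \<inter> {..<s}"
  shows "enters_by (W \<oplus> Y) s e n \<longleftrightarrow> enters_by (W \<oplus> Y') s e n"
proof (rule enters_by_cong)
  have "x \<in> W \<oplus> Y \<longleftrightarrow> x \<in> W \<oplus> Y'" if "x < s" for x
  proof -
    have "x div 2 < s" using that by simp
    then have "x div 2 \<in> Y \<longleftrightarrow> x div 2 \<in> Y'" using assms by auto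
    then show ?thesis by (simp add: join_iff)
  qed
  then show "(W \<oplus> Y) \<inter> {..<s} = (W \<oplus> Y') \<inter> {..<s}" by auto
qed

lemma effective_enters_by: "effective W (\<lambda>n Y s. enters_by (W \<oplus> Y) s e n)"
proof -
  have "finite_use (\<lambda>Y s. enters_by (W \<oplus> Y) s e n)" for n
    by (rule finite_useI) (use enters_by_join_cong in blast)
  moreover have "computable_rel W 3 (\<lambda>xs. enters_by (W \<oplus> set_decode (xs ! 1)) (xs ! 2) e (xs ! 0))"
    by (intro computable_rel_enters_by comp_intros computable_rel_oracle) simp_all
  ultimately show ?thesis by (simp add: effective_def)
qed

text \<open>Compactness replaces the quantifier over all sets by a bounded one over codes of strings.\<close>

lemma Sigma01_covering:
  assumes q: "effective W q" shows "Sigma01 W {n. \<forall>Y. \<exists>s. q n Y s}"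
proof -
  have fu: "finite_use (q n)" for n using q by (simp add: effective_def)
  \<comment> \<open>The codes \<open>d < 2 ^ s\<close> are those of the subsets of
    \<open>{..<s}\<close>, so \<open>?P n s\<close> says that the stages below \<open>s\<close>
    already cover all sets.\<close>
  let ?P = "\<lambda>n s. \<forall>d<2 ^ s. \<exists>t<s. q n (set_decode d) t"
  have "(\<forall>Y. \<exists>s. q n Y s) \<longleftrightarrow> (\<exists>s. ?P n s)" for n
  proof
    assume "\<forall>Y. \<exists>s. q n Y s"
    from finite_use_cover[OF fu this]
    show "\<exists>s. ?P n s" by auto
  next
    assume "\<exists>s. ?P n s"
    then obtain s where s: "?P n s" by blast
    show "\<forall>Y. \<exists>s. q n Y s"
    proof
      fix Y
      let ?d = "set_encode (Y \<inter> {..<s})"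
      have "?d < 2 ^ s"
      proof -
        have "?d \<le> sum (power 2) {0..<s}"
          unfolding set_encode_def by (rule sum_mono2) auto
        also have "\<dots> < 2 ^ s" by (simp add: sum_power2)
        finally show ?thesis .
      qed
      then obtain t where t: "t < s" "q n (set_decode ?d) t" using s by blast
      have "q n (set_decode ?d) t \<longleftrightarrow> q n Y t"
        by (rule finite_useD[OF fu]) (use t(1) in auto)
      then have "q n Y t" using t(2) by blast
      then show "\<exists>s. q n Y s" ..
    qed
  qed
  moreover have "computable_rel W 2 (\<lambda>xs. ?P (xs ! 0) (xs ! 1))"
    by (intro comp_intros effectiveD[OF q]) simp_all
  ultimately show ?thesis unfolding Sigma01_def by (intro exI[of _ "\<lambda>xs. ?P (xs ! 0) (xs ! 1)"]) simp
qed

section \<open>A basis theorem for effectively closed classes\<close>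

lemma countable_subset_range:
  assumes "countable S" obtains f :: "nat \<Rightarrow> 'a" where "S \<subseteq> range f"
  using assms by (metis countable_def empty_subsetI from_nat_into_surj subsetI rangeI)

text \<open>Lets the pairs of a set index and a program be enumerated by
  \<open>from_nat\<close>.\<close>

instance prog :: countable
  by countable_datatype

text \<open>Forcing with nonempty \<open>\<Pi>\<^sup>0\<^sub>1\<close> classes. The \<open>n\<close>
  that program \<open>e\<close> enumerates for every member of a class form a \<open>Sigma01\<close>
  set, which hence differs from \<open>f i\<close>. Either some \<open>n\<close> outside
  \<open>f i\<close> is enumerated for all members, or some \<open>n\<close> in \<open>f i\<close>
  is omitted for a member, and the class shrinks to such members.\<close>

lemma Pi01_class_avoiding:
  assumes q: "effective W (\<lambda>_. q)" "\<exists>Y. \<forall>s. \<not> q Y s"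
    and "countable \<A>" and \<A>: "\<And>A. A \<in> \<A> \<Longrightarrow> \<not> Sigma01 W A"
  shows "\<exists>Y. (\<forall>s. \<not> q Y s) \<and> (\<forall>A\<in>\<A>. \<not> Sigma01 (W \<oplus> Y) A)"
proof -
  obtain f :: "nat \<Rightarrow> nat set" where f: "\<A> \<subseteq> range f"
    using countable_subset_range[OF assms(3)] .
  define nonempty_class where "nonempty_class p \<longleftrightarrow> effective W (\<lambda>_. p) \<and> (\<exists>Y. \<forall>s. \<not> p Y s)" for p
  define req where "req p i e \<longleftrightarrow> (\<forall>Y. (\<forall>s. \<not> p Y s) \<longrightarrow> ce_set (W \<oplus> Y) e \<noteq> f i)"
    for p :: "nat set \<Rightarrow> nat \<Rightarrow> bool" and i e
  have step: "\<exists>p'. nonempty_class p' \<and> (\<forall>Y s. p Y s \<longrightarrow> p' Y s) \<and> req p' i e"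
    if p: "nonempty_class p" and i: "f i \<in> \<A>" for p i e
  proof -
    \<comment> \<open>Avoiding \<open>r n\<close> means staying in the class of \<open>p\<close> and
      keeping \<open>n\<close> out of the \<open>e\<close>-th set.\<close>
    define r where "r n Y s \<longleftrightarrow> p Y s \<or> enters_by (W \<oplus> Y) s e n" for n Y s
    have r: "effective W r"
      unfolding r_def using p effective_enters_by by (intro effective_disj) (auto simp: nonempty_class_def)
    then have "f i \<noteq> {n. \<forall>Y. \<exists>s. r n Y s}" using Sigma01_covering \<A>[OF i] by metis
    then consider n where "n \<notin> f i" "\<forall>Y. \<exists>s. r n Y s" | n Y where "n \<in> f i" "\<forall>s. \<not> r n Y s"
      by blast
    then show ?thesis
    proof cases
      case 1
      then have "n \<in> ce_set (W \<oplus> Y) e" if "\<forall>s. \<not> p Y s" for Y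
        using that by (auto simp: r_def ce_set_iff)
      then have "req p i e" using 1(1) unfolding req_def by metis
      then show ?thesis using p by blast
    next
      case 2
      have "n \<notin> ce_set (W \<oplus> Y) e" if "\<forall>s. \<not> r n Y s" for Y
        using that by (auto simp: r_def ce_set_iff)
      then have "req (r n) i e" using 2(1) unfolding req_def by metis
      moreover have "nonempty_class (r n)" using 2(2) effective_const[OF r] by (auto simp: nonempty_class_def)
      ultimately show ?thesis by (intro exI[of _ "r n"]) (simp add: r_def)
    qed
  qed
  \<comment> \<open>The number \<open>j\<close> codes a requirement \<open>(i, e)\<close>, which is
    met on passing from \<open>p j\<close> to \<open>p (Suc j)\<close>.\<close>
  have "\<exists>p. \<forall>j. (nonempty_class (p j) \<and> (j = 0 \<longrightarrow> p j = q)) \<and> ((\<forall>Y s. p j Y s \<longrightarrow> p (Suc j) Y s) \<and>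
      (case from_nat j of (i, e) \<Rightarrow> f i \<in> \<A> \<longrightarrow> req (p (Suc j)) i e))"
  proof (rule dependent_nat_choice)
    show "\<exists>p. nonempty_class p \<and> (0 = (0::nat) \<longrightarrow> p = q)" using q by (auto simp: nonempty_class_def)
  next
    fix p and j :: nat assume p: "nonempty_class p \<and> (j = 0 \<longrightarrow> p = q)"
    obtain i e where ie: "(from_nat j :: nat \<times> prog) = (i, e)" by (cases "from_nat j :: nat \<times> prog")
    show "\<exists>p'. (nonempty_class p' \<and> (Suc j = 0 \<longrightarrow> p' = q)) \<and> (\<forall>Y s. p Y s \<longrightarrow> p' Y s) \<and>
      (case from_nat j of (i, e) \<Rightarrow> f i \<in> \<A> \<longrightarrow> req p' i e)"
    proof (cases "f i \<in> \<A>")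
      case True
      then show ?thesis using step[of p i e] p ie by auto
    next
      case False
      then show ?thesis using p ie by (intro exI[of _ p]) simp
    qed
  qed
  then obtain p where *: "\<forall>j. (nonempty_class (p j) \<and> (j = 0 \<longrightarrow> p j = q)) \<and> ((\<forall>Y s. p j Y s \<longrightarrow> p (Suc j) Y s) \<and>
      (case from_nat j of (i, e) \<Rightarrow> f i \<in> \<A> \<longrightarrow> req (p (Suc j)) i e))" ..
  then have p: "nonempty_class (p j)" "p 0 = q" "p j Y s \<Longrightarrow> p (Suc j) Y s" for j Y s
    by simp_all
  have req: "case from_nat j of (i, e) \<Rightarrow> f i \<in> \<A> \<longrightarrow> req (p (Suc j)) i e" for j
    using *[THEN spec, of j] by (rule conjunct2[THEN conjunct2])
  have mono: "p k Y s" if "p j Y s" "j \<le> k" for j k Y s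
    using that(2) by (induction k rule: dec_induct) (use that(1) p(3) in auto)
  \<comment> \<open>Dovetailing merges all the open sets into one predicate fit for compactness.
    Below stage \<open>s\<close> it only concerns \<open>p j\<close> with \<open>j < s\<close>, and
    by monotonicity a member of the class of \<open>p s\<close> avoids all of these.\<close>
  have "\<exists>Y. \<forall>s. \<not> (\<exists>j\<le>s. \<exists>t\<le>s. p j Y t)"
  proof (rule cantor_space_compact)
    have fu: "finite_use (p j)" for j using p(1) by (auto simp: nonempty_class_def effective_def)
    show "finite_use (\<lambda>Y s. \<exists>j\<le>s. \<exists>t\<le>s. p j Y t)"
    proof (rule finite_useI)
      fix Y Y' :: "nat set" and s :: nat
      assume eq: "Y \<inter> {..<s} = Y' \<inter> {..<s}" and "\<exists>j\<le>s. \<exists>t\<le>s. p j Y t"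
      then obtain j t where jt: "j \<le> s" "t \<le> s" "p j Y t" by blast
      have "Y \<inter> {..<t} = Y' \<inter> {..<t}" using eq jt(2) by (force simp: set_eq_iff)
      then show "\<exists>j\<le>s. \<exists>t\<le>s. p j Y' t" using jt finite_useD[OF fu] by blast
    qed
    show "\<exists>Y. \<forall>t<s. \<not> (\<exists>j\<le>t. \<exists>u\<le>t. p j Y u)" for s
    proof -
      obtain Y where "\<forall>t. \<not> p s Y t" using p(1) by (auto simp: nonempty_class_def)
      then have "\<forall>t<s. \<not> (\<exists>j\<le>t. \<exists>u\<le>t. p j Y u)" using mono by (meson le_trans less_imp_le)
      then show ?thesis by blast
    qed
  qed
  then obtain Y where Y: "\<not> p j Y t" for j t by (meson le_cases order_refl)
  have "\<not> Sigma01 (W \<oplus> Y) A" if A: "A \<in> \<A>" for A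
  proof
    assume "Sigma01 (W \<oplus> Y) A"
    then obtain e where e: "A = ce_set (W \<oplus> Y) e" by (rule Sigma01_imp_ce_set)
    obtain i where i: "A = f i" using f A by blast
    have "req (p (Suc (to_nat (i, e)))) i e" using req[of "to_nat (i, e)"] A i by simp
    then show False using Y e i unfolding req_def by metis
  qed
  then show ?thesis using Y p(2) by metis
qed

section \<open>Mathias forcing for tournaments\<close>

text \<open>Used to bound quantifiers over the elements of a coded set by its code.\<close>

lemma set_decode_subset_lessThan: "set_decode c \<subseteq> {..<c}"
proof
  fix i assume "i \<in> set_decode c"
  then have "c div 2 ^ i \<noteq> 0" unfolding set_decode_def mem_Collect_eq by (metis even_zero)
  then have "2 ^ i \<le> c" by (metis div_less not_le)
  then show "i \<in> {..<c}" by (simp add: less_le_trans[OF less_exp])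
qed

lemma transitive_set_iff:
  "transitive_set R G \<longleftrightarrow>
    (\<forall>x\<in>G. \<forall>y\<in>G. \<forall>z\<in>G. (x, y) \<in> R \<longrightarrow> (y, z) \<in> R \<longrightarrow> (x, z) \<in> R)"
  unfolding transitive_set_def trans_def by blast

lemma transitive_set_subset: "transitive_set R G \<Longrightarrow> E \<subseteq> G \<Longrightarrow> transitive_set R E"
  unfolding transitive_set_iff by blast

lemma computable_binrel_mem:
  assumes "computable_binrel Z R" "reducible Z W" "computable_fun W k f" "computable_fun W k g"
  shows "computable_rel W k (\<lambda>xs. (f xs, g xs) \<in> R)"
proof -
  have "computable_rel W 2 (\<lambda>xs. (xs ! 0, xs ! 1) \<in> R)"
    using assms(1,2) reducible_computable_rel unfolding computable_binrel_def by blast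
  moreover have "computable_list W k (\<lambda>xs. [f xs, g xs])" by (intro comp_intros assms)
  ultimately have "computable_rel W k (\<lambda>xs. ([f xs, g xs] ! 0, [f xs, g xs] ! 1) \<in> R)"
    by (rule computable_rel_compose) simp
  then show ?thesis by simp
qed

text \<open>In the end \<open>\<A>\<close> is the family of all sets that are \<open>Delta02\<close>
  but not \<open>Sigma01\<close> in \<open>Z\<close>.\<close>

locale tournament_forcing =
  fixes Z :: "nat set" and R :: "(nat \<times> nat) set" and \<A> :: "nat set set"
  assumes asym: "(x, y) \<in> R \<Longrightarrow> (y, x) \<notin> R"
    and total: "x \<noteq> y \<Longrightarrow> (x, y) \<in> R \<or> (y, x) \<in> R"
    and computable: "computable_binrel Z R"
    and countable: "countable \<A>"
begin

text \<open>The last two clauses place \<open>X\<close> within one interval of the finite order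
  \<open>F\<close>: each point of \<open>X\<close> may be added, and all points of \<open>X\<close>
  lie on the same side of each point of \<open>F\<close>.\<close>

definition condition :: "nat set \<Rightarrow> nat set \<Rightarrow> bool" where
  "condition F X \<longleftrightarrow> finite F \<and> infinite X \<and> (\<forall>A\<in>\<A>. \<not> Sigma01 (Z \<oplus> X) A)
    \<and> (\<forall>x\<in>X. transitive_set R (insert x F))
    \<and> (\<forall>f\<in>F. (\<forall>x\<in>X. (f, x) \<in> R) \<or> (\<forall>x\<in>X. (x, f) \<in> R))"

text \<open>In a tournament transitivity can only fail on a 3-cycle. One inside \<open>F \<union> E\<close> with points in both
  \<open>F\<close> and \<open>E\<close> has either a single point in \<open>E\<close>, or a point of \<open>F\<close> that is on different sides of two
  points of \<open>X\<close>.\<close>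

lemma condition_transitive_Un:
  assumes cond: "condition F X" and E: "E \<subseteq> X" "transitive_set R E"
  shows "transitive_set R (F \<union> E)"
  unfolding transitive_set_iff
proof (intro ballI impI)
  fix x y z
  assume xyz: "x \<in> F \<union> E" "y \<in> F \<union> E" "z \<in> F \<union> E" "(x, y) \<in> R" "(y, z) \<in> R"
  \<comment> \<open>\<open>X\<close> is nonempty, and transitivity of \<open>insert w F\<close>
    restricts to \<open>F\<close>.\<close>
  obtain w where "w \<in> X" using cond by (metis condition_def finite.emptyI ex_in_conv)
  then have F: "(a, c) \<in> R" if "a \<in> F" "b \<in> F" "c \<in> F" "(a, b) \<in> R" "(b, c) \<in> R" for a b c
    using cond that unfolding condition_def transitive_set_iff by blast
  have one: "(a, c) \<in> R" if "a \<in> insert u F" "b \<in> insert u F" "c \<in> insert u F" "u \<in> E" "(a, b) \<in> R" "(b, c) \<in> R"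
    for a b c u
    using cond that E unfolding condition_def transitive_set_iff by blast
  have out: "(f, v) \<in> R" if "f \<in> F" "u \<in> E" "v \<in> E" "(f, u) \<in> R" for f u v
    using cond that E asym unfolding condition_def by blast
  have into: "(v, f) \<in> R" if "f \<in> F" "u \<in> E" "v \<in> E" "(u, f) \<in> R" for f u v
    using cond that E asym unfolding condition_def by blast
  show "(x, z) \<in> R"
  proof (cases "x \<in> E"; cases "y \<in> E"; cases "z \<in> E")
    assume "x \<in> E" "y \<in> E" "z \<in> E"
    then show ?thesis using E xyz unfolding transitive_set_iff by blast
  next
    assume "x \<in> E" "y \<in> E" "z \<notin> E"
    then show ?thesis using xyz into by blast
  next
    \<comment> \<open>Here \<open>y\<close> lies in \<open>F\<close>, after \<open>x\<close> and
      before \<open>z\<close>, although all of \<open>E\<close> is on one side of it.\<close>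
    assume "x \<in> E" "y \<notin> E" "z \<in> E"
    then show ?thesis using xyz into asym by blast
  next
    assume "x \<in> E" "y \<notin> E" "z \<notin> E"
    then show ?thesis using xyz one[of x x y z] by blast
  next
    assume "x \<notin> E" "y \<in> E" "z \<in> E"
    then show ?thesis using xyz out by blast
  next
    assume "x \<notin> E" "y \<in> E" "z \<notin> E"
    then show ?thesis using xyz one[of x y y z] by blast
  next
    assume "x \<notin> E" "y \<notin> E" "z \<in> E"
    then show ?thesis using xyz one[of x z y z] by blast
  next
    assume "x \<notin> E" "y \<notin> E" "z \<notin> E"
    then show ?thesis using xyz F by blast
  qed
qed

text \<open>Points of \<open>X\<close> from \<open>s\<close> on are sorted by their predecessors
  below \<open>s\<close>; every \<open>i < s\<close> thus points to all of a block or to none of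
  it.\<close>

definition block :: "nat set \<Rightarrow> nat \<Rightarrow> nat \<Rightarrow> nat set" where
  "block X s d = {x \<in> X. s \<le> x \<and> (\<forall>i<s. (i, x) \<in> R \<longleftrightarrow> i \<in> set_decode d)}"

text \<open>There are finitely many patterns of predecessors below \<open>s\<close>, so the
  pigeonhole principle applies.\<close>

lemma infinite_block:
  assumes "infinite X" obtains d where "infinite (block X s d)"
proof -
  let ?X = "{x \<in> X. s \<le> x}" and ?f = "\<lambda>x. {i. i < s \<and> (i, x) \<in> R}"
  have "?X = X - {..<s}" by auto
  then have "infinite ?X" using assms by simp
  moreover have "?f ` ?X \<subseteq> Pow {..<s}" by auto
  then have "finite (?f ` ?X)" by (rule finite_subset) simp
  ultimately obtain x0 where x0: "infinite {x \<in> ?X. ?f x = ?f x0}"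
    using pigeonhole_infinite[of ?X ?f] by blast
  have "finite (?f x0)" by simp
  then have "i < s \<Longrightarrow> i \<in> set_decode (set_encode (?f x0)) \<longleftrightarrow> (i, x0) \<in> R" for i
    by (simp add: set_encode_inverse)
  then have "{x \<in> ?X. ?f x = ?f x0} \<subseteq> block X s (set_encode (?f x0))"
    unfolding block_def by blast
  then show thesis using x0 that finite_subset by blast
qed

lemma reducible_block: "reducible (block X s d) (Z \<oplus> X)"
proof -
  have "computable_rel (Z \<oplus> X) 1 (\<lambda>xs. xs ! 0 \<in> X \<and> s \<le> xs ! 0 \<and>
      (\<forall>i<s. (i, xs ! 0) \<in> R \<longleftrightarrow> i \<in> set_decode d))"
    by (intro comp_intros computable_rel_join_components
        computable_binrel_mem[OF computable reducible_join_left]) simp_all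
  then show ?thesis by (simp add: reducible_def block_def)
qed

text \<open>For \<open>y\<close> in the block, all of \<open>E\<close> lies on one side of
  \<open>y\<close>, so \<open>insert y E\<close> is a transitive subset of \<open>X\<close> and may
  be added to \<open>F\<close>. The block is computable from \<open>Z \<oplus> X\<close> and so
  inherits the clause on \<open>\<A>\<close>.\<close>

lemma condition_extend:
  assumes cond: "condition F X" and E: "E \<subseteq> X" "transitive_set R E" "E \<subseteq> {..<s}"
    and inf: "infinite (block X s d)"
    and side: "E \<subseteq> set_decode d \<or> E \<inter> set_decode d = {}"
  shows "condition (F \<union> E) (block X s d)"
proof -
  let ?Y = "block X s d"
  have side': "(\<forall>e\<in>E. \<forall>y\<in>?Y. (e, y) \<in> R) \<or> (\<forall>e\<in>E. \<forall>y\<in>?Y. (y, e) \<in> R)"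
    using side
  proof
    assume "E \<subseteq> set_decode d"
    then have "\<forall>e\<in>E. \<forall>y\<in>?Y. (e, y) \<in> R" using E(3) by (auto simp: block_def)
    then show ?thesis ..
  next
    assume "E \<inter> set_decode d = {}"
    then have "(y, e) \<in> R" if "e \<in> E" "y \<in> ?Y" for e y
    proof -
      have "e < s" "e \<notin> set_decode d" using \<open>E \<inter> set_decode d = {}\<close> that(1) E(3) by auto
      then have "(e, y) \<notin> R" "e \<noteq> y" using that(2) by (auto simp: block_def)
      then show ?thesis using total by blast
    qed
    then show ?thesis by blast
  qed
  have "transitive_set R (insert y (F \<union> E))" if y: "y \<in> ?Y" for y
  proof -
    have "transitive_set R (insert y E)"
      using side' y E(2) asym unfolding transitive_set_iff by blast
    moreover have "insert y E \<subseteq> X" using y E(1) by (auto simp: block_def)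
    ultimately show ?thesis using condition_transitive_Un[OF cond] by (metis Un_insert_right)
  qed
  moreover have "\<not> Sigma01 (Z \<oplus> ?Y) A" if "A \<in> \<A>" for A
    using that cond reducible_Sigma01[OF reducible_join[OF reducible_join_left reducible_block]]
    unfolding condition_def by blast
  moreover have "(\<forall>x\<in>?Y. (f, x) \<in> R) \<or> (\<forall>x\<in>?Y. (x, f) \<in> R)" if "f \<in> F \<union> E" for f
    using that cond side' unfolding condition_def block_def by blast
  moreover have "finite E" using E(3) finite_subset by blast
  ultimately show ?thesis using cond inf unfolding condition_def by blast
qed

section \<open>Extending conditions and meeting requirements\<close>

definition extends :: "nat set \<Rightarrow> nat set \<Rightarrow> nat set \<Rightarrow> nat set \<Rightarrow> bool" where
  "extends F' X' F X \<longleftrightarrow> condition F' X' \<and> F \<subseteq> F' \<and> X' \<subseteq> X \<and> F' \<subseteq> F \<union> X"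

text \<open>Serves to make the generic set infinite. A singleton lies on one side of any partition,
  so \<open>condition_extend\<close> applies whatever \<open>d\<close> is.\<close>

lemma extends_proper:
  assumes cond: "condition F X" shows "\<exists>F' X'. extends F' X' F X \<and> F \<subset> F'"
proof -
  have "infinite (X - F)" using cond by (simp add: condition_def)
  then obtain x where x: "x \<in> X" "x \<notin> F" by (metis DiffE finite.emptyI ex_in_conv)
  obtain d where d: "infinite (block X (Suc x) d)"
    using infinite_block cond unfolding condition_def by metis
  have "transitive_set R {x}" by (simp add: transitive_set_iff)
  then have "condition (F \<union> {x}) (block X (Suc x) d)"
    using x d by (intro condition_extend[OF cond]) auto
  then have "extends (F \<union> {x}) (block X (Suc x) d) F X"
    using x(1) by (auto simp: extends_def block_def)
  then show ?thesis using x(2) by blast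
qed

text \<open>\<open>Y\<close> stands for the partition of \<open>X\<close> into
  \<open>X \<inter> Y\<close> and \<open>X - Y\<close>, and \<open>c\<close> codes a finite set
  inside one part. As \<open>c < s\<close>, only \<open>Y\<close> below \<open>s\<close>
  matters.\<close>

definition side_forces :: "nat set \<Rightarrow> nat set \<Rightarrow> prog \<Rightarrow> nat \<Rightarrow> nat set \<Rightarrow> nat \<Rightarrow> bool" where
  "side_forces F X e n Y s \<longleftrightarrow> (\<exists>c<s. \<exists>t<s. set_decode c \<subseteq> X \<and>
      (set_decode c \<subseteq> Y \<or> set_decode c \<inter> Y = {}) \<and> transitive_set R (set_decode c) \<and>
      enters_by (Z \<oplus> (F \<union> set_decode c)) t e n)"

lemma effective_side_forces:
  assumes "finite F" shows "effective (Z \<oplus> X) (side_forces F X e)"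
proof -
  let ?W = "Z \<oplus> X"
  have "finite_use (side_forces F X e n)" for n
  proof (rule finite_useI)
    fix Y Y' :: "nat set" and s :: nat
    assume eq: "Y \<inter> {..<s} = Y' \<inter> {..<s}" and "side_forces F X e n Y s"
    moreover have "set_decode c \<subseteq> Y \<longleftrightarrow> set_decode c \<subseteq> Y'"
      "set_decode c \<inter> Y = {} \<longleftrightarrow> set_decode c \<inter> Y' = {}" if "c < s" for c
    proof -
      have "set_decode c \<subseteq> {..<s}" using set_decode_subset_lessThan[of c] that by auto
      then show "set_decode c \<subseteq> Y \<longleftrightarrow> set_decode c \<subseteq> Y'"
        "set_decode c \<inter> Y = {} \<longleftrightarrow> set_decode c \<inter> Y' = {}"
        using eq by blast+
    qed
    ultimately show "side_forces F X e n Y' s" unfolding side_forces_def by meson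
  qed
  moreover have "computable_rel ?W 3 (\<lambda>xs. side_forces F X e (xs ! 0) (set_decode (xs ! 1)) (xs ! 2))"
  proof (rule computable_rel_cong)
    note R = computable_binrel_mem[OF computable reducible_join_left]
    \<comment> \<open>\<open>F\<close> enters as the constant \<open>set_encode F\<close>; what
      remains is an oracle indexed by the code of a finite set, as
      \<open>computable_rel_enters_by\<close> requires.\<close>
    have "computable_rel ?W 2 (\<lambda>xs. xs ! 0 div 2 \<in> set_decode (set_encode F) \<or> xs ! 0 div 2 \<in> set_decode (xs ! 1))"
      by (intro comp_intros) simp_all
    then have "computable_rel ?W 2 (\<lambda>xs. xs ! 0 div 2 \<in> F \<union> set_decode (xs ! 1))"
      by (simp add: set_encode_inverse assms)
    then have V: "computable_rel ?W 2 (\<lambda>xs. xs ! 0 \<in> Z \<oplus> (F \<union> set_decode (xs ! 1)))"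
      by (intro comp_intros computable_rel_join_components) simp_all
    \<comment> \<open>All quantifiers over elements of \<open>set_decode c\<close> are bounded by
      \<open>c\<close>.\<close>
    show "computable_rel ?W 3 (\<lambda>xs. \<exists>c<xs ! 2. \<exists>t<xs ! 2. (\<forall>i<c. i \<in> set_decode c \<longrightarrow> i \<in> X) \<and>
      ((\<forall>i<c. i \<in> set_decode c \<longrightarrow> i \<in> set_decode (xs ! 1)) \<or>
       (\<forall>i<c. i \<in> set_decode c \<longrightarrow> \<not> i \<in> set_decode (xs ! 1))) \<and>
      (\<forall>x<c. \<forall>y<c. \<forall>z<c. x \<in> set_decode c \<longrightarrow> y \<in> set_decode c \<longrightarrow> z \<in> set_decode c \<longrightarrow>
        (x, y) \<in> R \<longrightarrow> (y, z) \<in> R \<longrightarrow> (x, z) \<in> R) \<and>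
      enters_by (Z \<oplus> (F \<union> set_decode c)) t e (xs ! 0))"
      by (intro computable_rel_enters_by[OF V] comp_intros R computable_rel_join_components) simp_all
    have bounded: "(\<forall>i<c. i \<in> set_decode c \<longrightarrow> P i) \<longleftrightarrow> (\<forall>i\<in>set_decode c. P i)" for c P
      using set_decode_subset_lessThan[of c] by blast
    have "(\<forall>x<c. \<forall>y<c. \<forall>z<c. x \<in> set_decode c \<longrightarrow> y \<in> set_decode c \<longrightarrow> z \<in> set_decode c \<longrightarrow>
        (x, y) \<in> R \<longrightarrow> (y, z) \<in> R \<longrightarrow> (x, z) \<in> R) \<longleftrightarrow> transitive_set R (set_decode c)" for c
      using set_decode_subset_lessThan[of c] unfolding transitive_set_iff by blast
    then show "(\<exists>c<xs ! 2. \<exists>t<xs ! 2. (\<forall>i<c. i \<in> set_decode c \<longrightarrow> i \<in> X) \<and>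
      ((\<forall>i<c. i \<in> set_decode c \<longrightarrow> i \<in> set_decode (xs ! 1)) \<or>
       (\<forall>i<c. i \<in> set_decode c \<longrightarrow> \<not> i \<in> set_decode (xs ! 1))) \<and>
      (\<forall>x<c. \<forall>y<c. \<forall>z<c. x \<in> set_decode c \<longrightarrow> y \<in> set_decode c \<longrightarrow> z \<in> set_decode c \<longrightarrow>
        (x, y) \<in> R \<longrightarrow> (y, z) \<in> R \<longrightarrow> (x, z) \<in> R) \<and>
      enters_by (Z \<oplus> (F \<union> set_decode c)) t e (xs ! 0)) \<longleftrightarrow>
      side_forces F X e (xs ! 0) (set_decode (xs ! 1)) (xs ! 2)" for xs
      unfolding side_forces_def bounded subset_iff disjoint_iff Ball_def by (simp only:)
  qed
  ultimately show ?thesis by (simp add: effective_def)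
qed

text \<open>Speaking of all transitive \<open>G\<close> compatible with the condition makes the
  requirement pass to every further extension and to the generic set.\<close>

definition diagonalizes :: "nat set \<Rightarrow> nat set \<Rightarrow> prog \<Rightarrow> nat set \<Rightarrow> bool" where
  "diagonalizes F X e A \<longleftrightarrow>
    (\<forall>G. transitive_set R G \<longrightarrow> F \<subseteq> G \<longrightarrow> G \<subseteq> F \<union> X \<longrightarrow> ce_set (Z \<oplus> G) e \<noteq> A)"

lemma extends_diagonalizes:
  assumes cond: "condition F X" and A: "A \<in> \<A>"
  shows "\<exists>F' X'. extends F' X' F X \<and> diagonalizes F' X' e A"
proof -
  have F: "finite F" and X: "infinite X" and nce: "\<And>A. A \<in> \<A> \<Longrightarrow> \<not> Sigma01 (Z \<oplus> X) A"
    using cond by (auto simp: condition_def)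
  let ?q = "side_forces F X e"
  have q: "effective (Z \<oplus> X) ?q" using F by (rule effective_side_forces)
  from Sigma01_covering[OF q] nce[OF A] have "A \<noteq> {n. \<forall>Y. \<exists>s. ?q n Y s}" by metis
  then consider n where "n \<notin> A" "\<forall>Y. \<exists>s. ?q n Y s" | n where "n \<in> A" "\<exists>Y. \<forall>s. \<not> ?q n Y s"
    by blast
  then show ?thesis
  proof cases
    case 1
    have "finite_use (?q n)" using q by (simp add: effective_def)
    \<comment> \<open>Compactness yields one \<open>s\<close> for all partitions. It determines the
      block, whose \<open>d\<close> then supplies the partition: predecessors of the block against
      the rest.\<close>
    from finite_use_cover[OF this 1(2)] obtain s where s: "\<And>Y. \<exists>t<s. ?q n Y t" by blast
    obtain d where d: "infinite (block X s d)" using infinite_block[OF X] .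
    obtain c t where c: "c < s" "t < s" and E: "set_decode c \<subseteq> X" "transitive_set R (set_decode c)"
      "set_decode c \<subseteq> set_decode d \<or> set_decode c \<inter> set_decode d = {}"
      and n: "enters_by (Z \<oplus> (F \<union> set_decode c)) t e n"
      using s[of "set_decode d"] less_trans unfolding side_forces_def by metis
    let ?E = "set_decode c" and ?X = "block X s d"
    have "?E \<subseteq> {..<s}" using set_decode_subset_lessThan[of c] c(1) by auto
    with E d have "condition (F \<union> ?E) ?X" by (intro condition_extend[OF cond])
    then have "extends (F \<union> ?E) ?X F X" using E(1) by (auto simp: extends_def block_def)
    moreover have "diagonalizes (F \<union> ?E) ?X e A"
      unfolding diagonalizes_def
    proof (intro allI impI)
      fix G assume G: "F \<union> ?E \<subseteq> G" "G \<subseteq> F \<union> ?E \<union> ?X"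
      \<comment> \<open>The new points of \<open>G\<close> lie in the block, so they are at least
        \<open>s\<close> and hence beyond the use \<open>t\<close>.\<close>
      have "(F \<union> ?E) \<inter> {..<t} = G \<inter> {..<t}" using G c(2) by (auto simp: block_def)
      from n[unfolded enters_by_join_cong[OF this]] have "n \<in> ce_set (Z \<oplus> G) e"
        unfolding ce_set_iff ..
      then show "ce_set (Z \<oplus> G) e \<noteq> A" using 1(1) by blast
    qed
    ultimately show ?thesis by blast
  next
    case 2
    \<comment> \<open>The partitions that never force \<open>n\<close> form a nonempty effectively
      closed class, to which the basis theorem applies.\<close>
    obtain Y where Y: "\<forall>s. \<not> ?q n Y s" "\<And>A. A \<in> \<A> \<Longrightarrow> \<not> Sigma01 (Z \<oplus> X \<oplus> Y) A"
      using Pi01_class_avoiding[OF effective_const[OF q] 2(2) countable nce] by blast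
    obtain X' where X': "infinite X'" "X' = X \<inter> Y \<or> X' = X - Y"
    proof -
      have "X = X \<inter> Y \<union> (X - Y)" by blast
      then have "infinite (X \<inter> Y) \<or> infinite (X - Y)" using X by (metis finite_Un)
      then show thesis using that by blast
    qed
    have "reducible X' (Z \<oplus> X \<oplus> Y)"
    proof -
      note X = reducible_mem[OF reducible_trans[OF reducible_join_right[of X Z] reducible_join_left[of "Z \<oplus> X" Y]]]
      have "computable_rel (Z \<oplus> X \<oplus> Y) 1 (\<lambda>xs. xs ! 0 \<in> X \<and> xs ! 0 \<in> Y)"
        "computable_rel (Z \<oplus> X \<oplus> Y) 1 (\<lambda>xs. xs ! 0 \<in> X \<and> \<not> xs ! 0 \<in> Y)"
        by (intro comp_intros X computable_rel_join_components; simp)+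
      then show ?thesis using X'(2) by (auto simp: reducible_def)
    qed
    moreover have "reducible Z (Z \<oplus> X \<oplus> Y)"
      using reducible_trans reducible_join_left by blast
    ultimately have "reducible (Z \<oplus> X') (Z \<oplus> X \<oplus> Y)" by (intro reducible_join)
    then have "condition F X'"
      using cond X' Y(2) reducible_Sigma01 unfolding condition_def by blast
    then have "extends F X' F X" using X'(2) by (auto simp: extends_def)
    moreover have "diagonalizes F X' e A"
      unfolding diagonalizes_def
    proof (intro allI impI notI)
      fix G assume G: "transitive_set R G" "F \<subseteq> G" "G \<subseteq> F \<union> X'" and "ce_set (Z \<oplus> G) e = A"
      then obtain t where t: "enters_by (Z \<oplus> G) t e n" using 2(1) ce_set_iff by blast
      \<comment> \<open>If \<open>G\<close> put \<open>n\<close> into the set, its elements in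
        \<open>X'\<close> below the use \<open>t\<close> would form a finite transitive set inside
        one part of the partition, forcing \<open>n\<close>.\<close>
      let ?E = "G \<inter> X' \<inter> {..<t}"
      let ?c = "set_encode ?E"
      have c: "set_decode ?c = ?E" by (simp add: set_encode_inverse)
      have "(F \<union> ?E) \<inter> {..<t} = G \<inter> {..<t}" using G by blast
      from t[folded enters_by_join_cong[OF this]] have "enters_by (Z \<oplus> (F \<union> ?E)) t e n" .
      moreover have "transitive_set R ?E" using G(1) by (rule transitive_set_subset) blast
      moreover have "?E \<subseteq> X" "?E \<subseteq> Y \<or> ?E \<inter> Y = {}" using X'(2) by blast+
      \<comment> \<open>The bounds on code and stage in \<open>side_forces\<close> are strict, hence
        the \<open>Suc\<close>.\<close>
      moreover have "?c < Suc (max ?c t)" "t < Suc (max ?c t)" by simp_all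
      ultimately have "?q n Y (Suc (max ?c t))" unfolding side_forces_def by (metis c)
      then show False using Y(1) by blast
    qed
    ultimately show ?thesis by blast
  qed
qed

text \<open>In a descending chain of conditions, step \<open>j\<close> adds a point and meets the
  requirement coded by \<open>j\<close>. The union \<open>G\<close> of the finite parts is
  compatible with every condition of the chain.\<close>

lemma generic_exists:
  assumes Z: "\<And>A. A \<in> \<A> \<Longrightarrow> \<not> Sigma01 Z A"
  shows "\<exists>G. infinite G \<and> transitive_set R G \<and> (\<forall>A\<in>\<A>. \<not> Sigma01 (Z \<oplus> G) A)"
proof -
  obtain f :: "nat \<Rightarrow> nat set" where f: "\<A> \<subseteq> range f"
    using countable_subset_range[OF countable] .
  define chain where "chain j p p' \<longleftrightarrow> extends (fst p') (snd p') (fst p) (snd p) \<and> fst p \<subset> fst p' \<and>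
      (case from_nat j of (i, e) \<Rightarrow> f i \<in> \<A> \<longrightarrow> diagonalizes (fst p') (snd p') e (f i))"
    for j :: nat and p p' :: "nat set \<times> nat set"
  have "\<exists>p. \<forall>j. condition (fst (p j)) (snd (p j)) \<and> chain j (p j) (p (Suc j))"
  proof (rule dependent_nat_choice)
    \<comment> \<open>The chain starts with the full reservoir: \<open>UNIV\<close> is computable,
      so \<open>Z \<oplus> UNIV\<close> is reducible to \<open>Z\<close>.\<close>
    have "reducible UNIV Z" unfolding reducible_def
      using computable_rel_eq[OF computable_fun_const computable_fun_const, of Z 1 0 0] by simp
    then have "reducible (Z \<oplus> UNIV) Z" by (intro reducible_join reducible_refl)
    then have "condition {} UNIV"
      using Z reducible_Sigma01 by (auto simp: condition_def transitive_set_iff)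
    then show "\<exists>p. condition (fst p) (snd p)" by (intro exI[of _ "({}, UNIV)"]) simp
  next
    fix p :: "nat set \<times> nat set" and j :: nat
    assume p: "condition (fst p) (snd p)"
    obtain i e where ie: "(from_nat j :: nat \<times> prog) = (i, e)" by (cases "from_nat j :: nat \<times> prog")
    obtain F X where FX: "extends F X (fst p) (snd p)" "fst p \<subset> F" using extends_proper[OF p] by blast
    then have cond: "condition F X" by (simp add: extends_def)
    show "\<exists>p'. condition (fst p') (snd p') \<and> chain j p p'"
    proof (cases "f i \<in> \<A>")
      case True
      obtain F' X' where F': "extends F' X' F X" "diagonalizes F' X' e (f i)"
        using extends_diagonalizes[OF cond True] by blast
      then have "extends F' X' (fst p) (snd p)" "fst p \<subset> F'" using FX by (auto simp: extends_def)
      then show ?thesis using F' ie by (intro exI[of _ "(F', X')"]) (auto simp: chain_def extends_def)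
    next
      case False
      then show ?thesis using FX cond ie by (intro exI[of _ "(F, X)"]) (auto simp: chain_def)
    qed
  qed
  then obtain p where "\<forall>j. condition (fst (p j)) (snd (p j)) \<and> chain j (p j) (p (Suc j))" ..
  then have p: "condition (fst (p j)) (snd (p j))" and chain: "chain j (p j) (p (Suc j))" for j
    by simp_all
  define F X where "F j = fst (p j)" and "X j = snd (p j)" for j
  have ext: "extends (F (Suc j)) (X (Suc j)) (F j) (X j)" and grow: "F j \<subset> F (Suc j)" for j
    using chain[of j] by (auto simp: chain_def F_def X_def)
  define G where "G = (\<Union>j. F j)"
  have mono: "F j \<subseteq> F k" if "j \<le> k" for j k
    using grow by (intro lift_Suc_mono_le[OF _ that]) blast
  have later: "F k \<subseteq> F j \<union> X j \<and> X k \<subseteq> X j" if "j \<le> k" for j k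
    using that
  proof (induction k rule: dec_induct)
    case (step k)
    then show ?case using ext[of k] unfolding extends_def by blast
  qed simp
  have G: "F j \<subseteq> G" "G \<subseteq> F j \<union> X j" for j
  proof -
    show "F j \<subseteq> G" by (auto simp: G_def)
    show "G \<subseteq> F j \<union> X j"
    proof
      fix x assume "x \<in> G"
      then obtain k where k: "x \<in> F k" by (auto simp: G_def)
      then show "x \<in> F j \<union> X j" using mono[of k j] later[of j k] by (cases "j \<le> k") auto
    qed
  qed
  have trans: "transitive_set R G"
    unfolding transitive_set_iff
  proof (intro ballI impI)
    fix x y z assume xyz: "x \<in> G" "y \<in> G" "z \<in> G" "(x, y) \<in> R" "(y, z) \<in> R"
    then obtain i j k where "x \<in> F i" "y \<in> F j" "z \<in> F k" by (auto simp: G_def)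
    then have "x \<in> F (i + j + k)" "y \<in> F (i + j + k)" "z \<in> F (i + j + k)"
      using mono[of i "i + j + k"] mono[of j "i + j + k"] mono[of k "i + j + k"] by auto
    moreover have "transitive_set R {}" by (simp add: transitive_set_iff)
    from condition_transitive_Un[OF p empty_subsetI this] have "transitive_set R (F (i + j + k))"
      unfolding F_def by simp
    ultimately show "(x, z) \<in> R" using xyz unfolding transitive_set_iff by blast
  qed
  moreover have "infinite G"
  proof
    assume fin: "finite G"
    have "j \<le> card (F j)" for j
    proof (induction j)
      case (Suc j)
      have "card (F j) < card (F (Suc j))"
        by (intro psubset_card_mono finite_subset[OF G(1) fin] grow)
      then show ?case using Suc by simp
    qed simp
    then have "Suc (card G) \<le> card (F (Suc (card G)))" .
    then show False using card_mono[OF fin G(1)[of "Suc (card G)"]] by simp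
  qed
  moreover have "\<not> Sigma01 (Z \<oplus> G) A" if A: "A \<in> \<A>" for A
  proof
    assume "Sigma01 (Z \<oplus> G) A"
    then obtain e where e: "A = ce_set (Z \<oplus> G) e" by (rule Sigma01_imp_ce_set)
    obtain i where i: "A = f i" using f A by blast
    let ?j = "to_nat (i, e)"
    have "diagonalizes (F (Suc ?j)) (X (Suc ?j)) e A"
      using chain[of ?j] A i by (simp add: chain_def F_def X_def)
    then show False using e G trans unfolding diagonalizes_def by blast
  qed
  ultimately show ?thesis by blast
qed

end

section \<open>Preservation of definitions\<close>

lemma tournament_asym_total:
  assumes "tournament R"
  shows "(x, y) \<in> R \<Longrightarrow> (y, x) \<notin> R" "x \<noteq> y \<Longrightarrow> (x, y) \<in> R \<or> (y, x) \<in> R"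
proof -
  obtain c where c: "c \<in> nsets (UNIV :: nat set) 2 \<rightarrow> {0, 1}" and "induced_by R c"
    using assms unfolding tournament_def by blast
  then have R: "R = {(x, y). x < y \<and> c {x, y} = 1} \<union> {(y, x) | x y. x < y \<and> c {x, y} = 0}"
    unfolding induced_by_def by blast
  show "(y, x) \<notin> R" if "(x, y) \<in> R" using that by (auto simp: R)
  show "(x, y) \<in> R \<or> (y, x) \<in> R" if "x \<noteq> y"
  proof -
    have "{x, y} \<in> nsets (UNIV :: nat set) 2" using that by (simp add: nsets_def)
    then have "c {x, y} = 0 \<or> c {x, y} = 1" using c by auto
    then show ?thesis using that insert_commute[of x y "{}"] by (cases "x < y") (auto simp: R)
  qed
qed

text \<open>Each such set has a \<open>Sigma02\<close> definition, which is determined by a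
  program.\<close>

lemma countable_Delta02: "countable {A. Delta02 Z A}"
proof (rule countable_subset)
  show "{A. Delta02 Z A} \<subseteq> range (\<lambda>e. {x. \<exists>y. \<forall>z. eval Z e [x, y, z] 1})"
  proof
    fix A assume "A \<in> {A. Delta02 Z A}"
    then obtain P where P: "computable_rel Z 3 P" "A = {x. \<exists>y. \<forall>z. P [x, y, z]}"
      by (auto simp: Delta02_def Sigma02_def)
    obtain e where e: "\<forall>xs. length xs = 3 \<longrightarrow> eval Z e xs (if P xs then 1 else 0)"
      using P(1) by (auto simp: computable_rel_def)
    have "P [x, y, z] \<longleftrightarrow> eval Z e [x, y, z] 1" for x y z
      using e[THEN spec, of "[x, y, z]"] eval_functional by (fastforce split: if_splits)
    then show "A \<in> range (\<lambda>e. {x. \<exists>y. \<forall>z. eval Z e [x, y, z] 1})" using P(2) by auto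
  qed
qed simp

lemma Pi01_imp_Sigma01_Compl: "Pi01 X A \<Longrightarrow> Sigma01 X (- A)"
proof -
  assume "Pi01 X A"
  then obtain P where P: "computable_rel X 2 P" "A = {x. \<forall>y. P [x, y]}" by (auto simp: Pi01_def)
  from P(1) have "computable_rel X 2 (\<lambda>xs. \<not> P xs)" by (rule computable_rel_not)
  then show "Sigma01 X (- A)" using P(2) unfolding Sigma01_def by blast
qed

lemma Sigma01_imp_Pi01_Compl: "Sigma01 X A \<Longrightarrow> Pi01 X (- A)"
proof -
  assume "Sigma01 X A"
  then obtain P where P: "computable_rel X 2 P" "A = {x. \<exists>y. P [x, y]}" by (auto simp: Sigma01_def)
  from P(1) have "computable_rel X 2 (\<lambda>xs. \<not> P xs)" by (rule computable_rel_not)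
  then show "Pi01 X (- A)" using P(2) unfolding Pi01_def by blast
qed

lemma Delta02_Compl:
  assumes "Delta02 X A" shows "Delta02 X (- A)"
proof -
  obtain P Q where P: "computable_rel X 3 P" "A = {x. \<exists>y. \<forall>z. P [x, y, z]}"
    and Q: "computable_rel X 3 Q" "A = {x. \<forall>y. \<exists>z. Q [x, y, z]}"
    using assms by (auto simp: Delta02_def Sigma02_def Pi02_def)
  have "- A = {x. \<forall>y. \<exists>z. \<not> P [x, y, z]}" using P(2) by blast
  moreover have "- A = {x. \<exists>y. \<forall>z. \<not> Q [x, y, z]}" using Q(2) by blast
  ultimately show ?thesis
    using computable_rel_not[OF P(1)] computable_rel_not[OF Q(1)]
    unfolding Delta02_def Sigma02_def Pi02_def by blast
qed

theorem theorem3p17: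
  fixes Z :: "nat set" and R :: "(nat \<times> nat) set"
  assumes "tournament R" and "computable_binrel Z R"
  shows "\<exists>G :: nat set. infinite G \<and> transitive_set R G \<and> preserves_Delta02_definitions Z G"
proof -
  let ?A = "{A. Delta02 Z A \<and> \<not> Sigma01 Z A}"
  interpret tournament_forcing Z R ?A
  proof
    show "countable ?A" by (rule countable_subset[OF _ countable_Delta02[of Z]]) blast
  qed (use assms tournament_asym_total in blast)+
  obtain G where G: "infinite G" "transitive_set R G"
    "\<And>A. Delta02 Z A \<Longrightarrow> \<not> Sigma01 Z A \<Longrightarrow> \<not> Sigma01 (Z \<oplus> G) A"
    using generic_exists by auto
  have "properly_Delta02 (Z \<oplus> G) A" if A: "properly_Delta02 Z A" for A
  proof -
    have A': "Delta02 Z A" "\<not> Sigma01 Z A" "\<not> Pi01 Z A" using A by (auto simp: properly_Delta02_def)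
    \<comment> \<open>As \<open>A\<close> is not \<open>Pi01\<close>, its complement belongs to the
      family as well; staying out of \<open>Sigma01\<close> in \<open>Z \<oplus> G\<close>, it keeps
      \<open>A\<close> from becoming \<open>Pi01\<close>.\<close>
    have "\<not> Sigma01 Z (- A)" using A'(3) Sigma01_imp_Pi01_Compl by fastforce
    then have "\<not> Pi01 (Z \<oplus> G) A"
      using G(3)[OF Delta02_Compl[OF A'(1)]] Pi01_imp_Sigma01_Compl by blast
    then show ?thesis
      using G(3) A' reducible_Delta02[OF reducible_join_left] by (simp add: properly_Delta02_def)
  qed
  then show ?thesis using G(1,2) unfolding preserves_Delta02_definitions_def by blast
qed

end
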